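(* Suppose $f : \mathbb{X}_{d,0} \to \mathbb{R}$ is a continuous intrinsic function and $\Omega \subset \mathbb{C}^d$ is a bounded convex domain with $C^2$ boundary. If $\xi \in \partial\Omega$ is a strongly pseudoconvex point of $\partial \Omega$, then $$\lim_{z \to \xi} f(\Omega, z) = f(\mathcal{B}, 0).$$
   Context: $\mathcal{B} \subset \mathbb{C}^d$ is the unit ball. $\mathbb{X}_d$ is the set of convex domains in $\mathbb{C}^d$ which do not contain a complex affine line, and $\mathbb{X}_{d,0}$ is the set of pairs $(\Omega,x)$ with $\Omega \in \mathbb{X}_d$, $x \in \Omega$. A function $f : \mathbb{X}_{d,0} \to \mathbb{R}$ is intrinsic if $f(\Omega_1,p_1) = f(\Omega_2,p_2)$ whenever there is a biholomorphism $\varphi : \Omega_1 \to \Omega_2$ with $\varphi(p_1) = p_2$. Topology: for compact sets, $d_H$ is the Hausdorff distance (for the Euclidean distance); for $R>0$ and closed $A, B$, let $d_H^{(R)}(A,B) = d_H(A \cap B_R(0), B \cap B_R(0))$, with $B_R(0)$ the closed Euclidean ball. Open convex sets $\Omega_n$ converge to an open convex set $\Omega$ in the local Hausdorff topology if there is $R_0 \geq 0$ with $\lim_{n\to\infty} d_H^{(R)}(\overline{\Omega}_n, \overline{\Omega}) = 0$ for all $R \geq R_0$. $\mathbb{X}_d$ carries the local Hausdorff topology; $(\Omega_n,x_n) \to (\Omega,x)$ in $\mathbb{X}_{d,0}$ means $\Omega_n \to \Omega$ in the local Hausdorff topology and $x_n \to x$. *)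

theory Defs
  imports "HOL-Analysis.Analysis"
begin

section \<open>Holomorphic maps in several variables\<close>

definition holomorphic_map_on :: "(complex^'d \<Rightarrow> complex^'d) \<Rightarrow> (complex^'d) set \<Rightarrow> bool"
  where "holomorphic_map_on \<phi> \<Omega> \<longleftrightarrow>
    (\<forall>z\<in>\<Omega>. \<exists>A :: complex^'d^'d. (\<phi> has_derivative (\<lambda>v. A *v v)) (at z))"

definition biholomorphism :: "(complex^'d \<Rightarrow> complex^'d) \<Rightarrow> (complex^'d) set \<Rightarrow> (complex^'d) set \<Rightarrow> bool"
  where "biholomorphism \<phi> \<Omega>1 \<Omega>2 \<longleftrightarrow>
    holomorphic_map_on \<phi> \<Omega>1 \<and> bij_betw \<phi> \<Omega>1 \<Omega>2 \<and>
    (\<exists>\<psi>. holomorphic_map_on \<psi> \<Omega>2 \<and> (\<forall>z\<in>\<Omega>1. \<psi> (\<phi> z) = z))"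


section \<open>The spaces of convex domains and of pointed convex domains\<close>

definition convex_domain :: "(complex^'d) set \<Rightarrow> bool"
  where "convex_domain \<Omega> \<longleftrightarrow> open \<Omega> \<and> convex \<Omega> \<and> \<Omega> \<noteq> {}"

definition complex_affine_line :: "(complex^'d) set \<Rightarrow> bool"
  where "complex_affine_line L \<longleftrightarrow> (\<exists>p v. v \<noteq> 0 \<and> L = range (\<lambda>t::complex. p + t *s v))"

definition \<X> :: "(complex^'d) set set"
  where "\<X> = {\<Omega>. convex_domain \<Omega> \<and> \<not> (\<exists>L. complex_affine_line L \<and> L \<subseteq> \<Omega>)}"

definition \<X>\<^sub>0 :: "((complex^'d) set \<times> (complex^'d)) set"
  where "\<X>\<^sub>0 = {(\<Omega>, x). \<Omega> \<in> \<X> \<and> x \<in> \<Omega>}"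

definition intrinsic :: "((complex^'d) set \<times> (complex^'d) \<Rightarrow> real) \<Rightarrow> bool"
  where "intrinsic f \<longleftrightarrow>
    (\<forall>\<Omega>1 p1 \<Omega>2 p2 \<phi>. (\<Omega>1, p1) \<in> \<X>\<^sub>0 \<longrightarrow> (\<Omega>2, p2) \<in> \<X>\<^sub>0 \<longrightarrow>
       biholomorphism \<phi> \<Omega>1 \<Omega>2 \<longrightarrow> \<phi> p1 = p2 \<longrightarrow> f (\<Omega>1, p1) = f (\<Omega>2, p2))"


section \<open>The local Hausdorff topology\<close>

text \<open>Values are extended nonnegative reals, so that the distance between the empty set and a
  nonempty set is infinite (and not an unspecified real number).\<close>

definition hausdorff_distance :: "'a::metric_space set \<Rightarrow> 'a set \<Rightarrow> ennreal"
  where "hausdorff_distance A B =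
    max (SUP a\<in>A. INF b\<in>B. ennreal (dist a b)) (SUP b\<in>B. INF a\<in>A. ennreal (dist a b))"

definition local_hausdorff_distance ::
  "real \<Rightarrow> 'a::real_normed_vector set \<Rightarrow> 'a set \<Rightarrow> ennreal"
  where "local_hausdorff_distance R A B = hausdorff_distance (A \<inter> cball 0 R) (B \<inter> cball 0 R)"

definition local_hausdorff_converges :: "(nat \<Rightarrow> 'a::real_normed_vector set) \<Rightarrow> 'a set \<Rightarrow> bool"
  where "local_hausdorff_converges \<Omega>s \<Omega> \<longleftrightarrow>
    (\<exists>R0\<ge>0. \<forall>R\<ge>R0.
       (\<lambda>n. local_hausdorff_distance R (closure (\<Omega>s n)) (closure \<Omega>)) \<longlonglongrightarrow> 0)"

definition pointed_converges ::
  "(nat \<Rightarrow> 'a::real_normed_vector set \<times> 'a) \<Rightarrow> 'a set \<times> 'a \<Rightarrow> bool"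
  where "pointed_converges S p \<longleftrightarrow>
    local_hausdorff_converges (\<lambda>n. fst (S n)) (fst p) \<and> (\<lambda>n. snd (S n)) \<longlonglongrightarrow> snd p"

text \<open>The topology is specified through its convergent sequences: a set of pointed domains is
  open iff every sequence converging to one of its members is eventually in it. By
  \<open>continuous_pointed_iff\<close> below, continuity is the same as preservation of limits of sequences.\<close>

definition open_pointed :: "((complex^'d) set \<times> (complex^'d)) set \<Rightarrow> bool"
  where "open_pointed U \<longleftrightarrow> U \<subseteq> \<X>\<^sub>0 \<and>
    (\<forall>S p. range S \<subseteq> \<X>\<^sub>0 \<longrightarrow> p \<in> U \<longrightarrow> pointed_converges S p \<longrightarrow>
       (\<forall>\<^sub>F n in sequentially. S n \<in> U))"

definition local_hausdorff_topology :: "((complex^'d) set \<times> (complex^'d)) topology"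
  where "local_hausdorff_topology = topology open_pointed"

lemma istopology_open_pointed: "istopology open_pointed"
  unfolding istopology_def
proof (intro conjI allI impI)
  fix U V :: "((complex^'d) set \<times> (complex^'d)) set"
  assume "open_pointed U" "open_pointed V"
  then show "open_pointed (U \<inter> V)"
    unfolding open_pointed_def by (auto simp: eventually_conj_iff)
next
  fix K :: "((complex^'d) set \<times> (complex^'d)) set set"
  assume K: "\<forall>U\<in>K. open_pointed U"
  show "open_pointed (\<Union>K)"
    unfolding open_pointed_def
  proof (intro conjI allI impI)
    show "\<Union>K \<subseteq> \<X>\<^sub>0" using K unfolding open_pointed_def by blast
  next
    fix S :: "nat \<Rightarrow> (complex^'d) set \<times> (complex^'d)" and p
    assume *: "range S \<subseteq> \<X>\<^sub>0" "p \<in> \<Union>K" "pointed_converges S p"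
    then obtain U where "U \<in> K" "p \<in> U" by blast
    with K * have "\<forall>\<^sub>F n in sequentially. S n \<in> U"
      unfolding open_pointed_def by blast
    then show "\<forall>\<^sub>F n in sequentially. S n \<in> \<Union>K"
      by (rule eventually_mono) (use \<open>U \<in> K\<close> in blast)
  qed
qed

lemma openin_local_hausdorff_topology:
  "openin local_hausdorff_topology U \<longleftrightarrow> open_pointed U"
  by (simp add: local_hausdorff_topology_def istopology_open_pointed)

lemma topspace_local_hausdorff_topology [simp]: "topspace local_hausdorff_topology = \<X>\<^sub>0"
proof -
  have "open_pointed \<X>\<^sub>0"
    unfolding open_pointed_def by (auto intro: always_eventually)
  then show ?thesis
    by (auto simp: topspace_def openin_local_hausdorff_topology open_pointed_def)
qed

lemma continuous_pointed_iff:
  fixes f :: "(complex^'d) set \<times> (complex^'d) \<Rightarrow> real"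
  shows "continuous_map local_hausdorff_topology euclideanreal f \<longleftrightarrow>
    (\<forall>S p. range S \<subseteq> \<X>\<^sub>0 \<longrightarrow> p \<in> \<X>\<^sub>0 \<longrightarrow> pointed_converges S p \<longrightarrow> (\<lambda>n. f (S n)) \<longlonglongrightarrow> f p)"
    (is "?C \<longleftrightarrow> ?S")
proof
  assume C: ?C
  show ?S
  proof (intro allI impI)
    fix S :: "nat \<Rightarrow> (complex^'d) set \<times> (complex^'d)" and p
    assume *: "range S \<subseteq> \<X>\<^sub>0" "p \<in> \<X>\<^sub>0" "pointed_converges S p"
    show "(\<lambda>n. f (S n)) \<longlonglongrightarrow> f p"
    proof (rule topological_tendstoI)
      fix V :: "real set"
      assume "open V" "f p \<in> V"
      have "open_pointed {x \<in> \<X>\<^sub>0. f x \<in> V}"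
        using C \<open>open V\<close> by (simp add: continuous_map_def openin_local_hausdorff_topology)
      with * \<open>f p \<in> V\<close> have "\<forall>\<^sub>F n in sequentially. S n \<in> {x \<in> \<X>\<^sub>0. f x \<in> V}"
        unfolding open_pointed_def by blast
      then show "\<forall>\<^sub>F n in sequentially. f (S n) \<in> V"
        by (rule eventually_mono) simp
    qed
  qed
next
  assume S: ?S
  have "open_pointed {x \<in> \<X>\<^sub>0. f x \<in> V}" if "open V" for V
    unfolding open_pointed_def
  proof (intro conjI allI impI)
    show "{x \<in> \<X>\<^sub>0. f x \<in> V} \<subseteq> \<X>\<^sub>0" by blast
  next
    fix S :: "nat \<Rightarrow> (complex^'d) set \<times> (complex^'d)" and p
    assume *: "range S \<subseteq> \<X>\<^sub>0" "p \<in> {x \<in> \<X>\<^sub>0. f x \<in> V}" "pointed_converges S p"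
    then have "(\<lambda>n. f (S n)) \<longlonglongrightarrow> f p" using S by blast
    then have "\<forall>\<^sub>F n in sequentially. f (S n) \<in> V"
      using * \<open>open V\<close> by (auto dest: topological_tendstoD)
    then show "\<forall>\<^sub>F n in sequentially. S n \<in> {x \<in> \<X>\<^sub>0. f x \<in> V}"
      by (rule eventually_mono) (use * in blast)
  qed
  then show ?C
    by (simp add: continuous_map_def openin_local_hausdorff_topology)
qed


section \<open>$C^2$ boundaries and strong pseudoconvexity\<close>

definition C2_on :: "'a::real_normed_vector set \<Rightarrow> ('a \<Rightarrow> real) \<Rightarrow> bool"
  where "C2_on U r \<longleftrightarrow>
    (\<exists>(r' :: 'a \<Rightarrow> 'a \<Rightarrow>\<^sub>L real) (r'' :: 'a \<Rightarrow> 'a \<Rightarrow>\<^sub>L ('a \<Rightarrow>\<^sub>L real)).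
       (\<forall>x\<in>U. (r has_derivative blinfun_apply (r' x)) (at x)) \<and>
       (\<forall>x\<in>U. (r' has_derivative blinfun_apply (r'' x)) (at x)) \<and>
       continuous_on U r'')"

definition C2_defining_function ::
  "'a::real_normed_vector set \<Rightarrow> 'a \<Rightarrow> 'a set \<Rightarrow> ('a \<Rightarrow> real) \<Rightarrow> bool"
  where "C2_defining_function \<Omega> \<xi> U r \<longleftrightarrow>
    open U \<and> \<xi> \<in> U \<and> C2_on U r \<and>
    \<Omega> \<inter> U = {z \<in> U. r z < 0} \<and> frontier \<Omega> \<inter> U = {z \<in> U. r z = 0} \<and>
    (\<forall>z\<in>U. \<exists>v. frechet_derivative r (at z) v \<noteq> 0)"

definition C2_boundary :: "'a::real_normed_vector set \<Rightarrow> bool"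
  where "C2_boundary \<Omega> \<longleftrightarrow> (\<forall>\<xi>\<in>frontier \<Omega>. \<exists>U r. C2_defining_function \<Omega> \<xi> U r)"

text \<open>The Wirtinger derivatives $\partial/\partial z_j = \frac12(\partial/\partial x_j -
  i\,\partial/\partial y_j)$ and $\partial/\partial \bar z_j = \frac12(\partial/\partial x_j +
  i\,\partial/\partial y_j)$; \<open>axis j 1\<close> and \<open>axis j \<i>\<close> are the $x_j$ and $y_j$ directions.\<close>

definition wirtinger :: "'d \<Rightarrow> (complex^'d \<Rightarrow> complex) \<Rightarrow> complex^'d \<Rightarrow> complex"
  where "wirtinger j g z =
    (frechet_derivative g (at z) (axis j 1) - \<i> * frechet_derivative g (at z) (axis j \<i>)) / 2"

definition wirtinger_bar :: "'d \<Rightarrow> (complex^'d \<Rightarrow> complex) \<Rightarrow> complex^'d \<Rightarrow> complex"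
  where "wirtinger_bar j g z =
    (frechet_derivative g (at z) (axis j 1) + \<i> * frechet_derivative g (at z) (axis j \<i>)) / 2"

definition levi_form :: "(complex^'d \<Rightarrow> real) \<Rightarrow> complex^'d \<Rightarrow> complex^'d \<Rightarrow> complex"
  where "levi_form r z v =
    (\<Sum>j\<in>UNIV. \<Sum>k\<in>UNIV.
       wirtinger j (wirtinger_bar k (\<lambda>w. complex_of_real (r w))) z * v $ j * cnj (v $ k))"

definition complex_tangent :: "(complex^'d \<Rightarrow> real) \<Rightarrow> complex^'d \<Rightarrow> (complex^'d) set"
  where "complex_tangent r z =
    {v. (\<Sum>j\<in>UNIV. wirtinger j (\<lambda>w. complex_of_real (r w)) z * v $ j) = 0}"

text \<open>The Levi form of a real $C^2$ function is real-valued, so \<open>Re\<close> below discards nothing. The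
  condition does not depend on the choice of the defining function.\<close>

definition strongly_pseudoconvex_at :: "(complex^'d) set \<Rightarrow> complex^'d \<Rightarrow> bool"
  where "strongly_pseudoconvex_at \<Omega> \<xi> \<longleftrightarrow>
    \<xi> \<in> frontier \<Omega> \<and>
    (\<exists>U r. C2_defining_function \<Omega> \<xi> U r \<and>
       (\<forall>v \<in> complex_tangent r \<xi>. v \<noteq> 0 \<longrightarrow> 0 < Re (levi_form r \<xi> v)))"

end

theory Submission
  imports Defs
begin

text \<open>
  The proof is a rescaling argument. Let \<open>r\<close> be a defining function near \<open>\<xi>\<close>, let \<open>\<alpha>\<^sub>z\<close> be the
  complex-linear form whose real part is the differential of \<open>r\<close> at \<open>z\<close>, and choose \<open>e\<close> with
  \<open>\<alpha>\<^sub>\<xi> e = 1\<close>. For \<open>z \<in> \<Omega>\<close> near \<open>\<xi>\<close> put \<open>t = - r z > 0\<close> and zoom in at \<open>z\<close> by a complex affine map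
  that stretches the direction \<open>e\<close> by \<open>1 / t\<close> and carries the kernel of \<open>\<alpha>\<^sub>z\<close>, stretched by
  \<open>1 / sqrt t\<close>, to the kernel of \<open>\<alpha>\<^sub>\<xi>\<close>. It takes \<open>z\<close> to \<open>0\<close> and \<open>\<Omega>\<close> to a convex domain \<open>\<Omega>\<^sub>z\<close>, so
  \<open>f (\<Omega>, z) = f (\<Omega>\<^sub>z, 0)\<close> because \<open>f\<close> is intrinsic. The expansion is made at the interior point \<open>z\<close>
  itself, whose value \<open>r z = - t\<close> becomes the constant term \<open>- 1\<close> of the limit.

  By Taylor's formula the function \<open>r\<close>, rescaled and divided by \<open>t\<close>, converges locally uniformly to
  \<open>\<rho> w = - 1 + Re (\<alpha>\<^sub>\<xi> w) + H (P w) (P w) / 2\<close>, with \<open>H\<close> the real Hessian of \<open>r\<close> at \<open>\<xi>\<close> and \<open>P\<close> the projection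
  to the complex tangent space along \<open>e\<close>. Convexity of \<open>\<Omega>\<close> makes \<open>H\<close> positive semidefinite on that space;
  hence \<open>D = {\<rho> < 0}\<close> is convex, and the estimate \<open>\<rho> (s w) \<le> s \<rho> w - (1 - s)\<close> turns uniform convergence
  of the functions into local Hausdorff convergence of \<open>\<Omega>\<^sub>z\<close> to \<open>D\<close> (\<open>scaled_converges\<close>). Strong
  pseudoconvexity excludes complex lines in \<open>D\<close> (\<open>no_complex_line_in_D\<close>). Continuity of \<open>f\<close> then gives
  \<open>f (\<Omega>, z) \<longlongrightarrow> f (D, 0)\<close>.

  Finally \<open>(D, 0)\<close> is biholomorphic to the ball with its centre (\<open>biholomorphic_to_ball\<close>). Half the
  Hessian on the complex tangent space is the Levi form plus the real part of a complex quadratic form. A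
  shear absorbs the latter, which leaves a Siegel domain. A Cayley transform maps this onto the unit
  ball of a Hermitian norm, and Gram-Schmidt identifies that ball with the standard one.
\<close>

section \<open>Complex-linear maps and Hermitian forms\<close>

lemma norm_vector_scalar_mult: "norm (c *s v) = norm c * norm v" for c :: complex and v :: "complex^'d"
  by (simp add: norm_vec_def norm_mult L2_set_right_distrib)

lemma scaleR_eq_vector_scalar_mult: "a *\<^sub>R v = complex_of_real a *s v" for v :: "complex^'d"
  by (simp add: vec_eq_iff scaleR_conv_of_real[where 'a=complex])

lemma bounded_bilinear_vector_scalar_mult:
  "bounded_bilinear ((*s) :: complex \<Rightarrow> complex^'d \<Rightarrow> complex^'d)"
proof
  show "\<exists>K. \<forall>c (v :: complex^'d). norm (c *s v) \<le> norm c * norm v * K"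
    by (rule exI[of _ 1]) (simp add: norm_vector_scalar_mult)
qed (simp_all add: vec_eq_iff algebra_simps scaleR_conv_of_real[where 'a=complex])

lemmas has_derivative_vector_scalar_mult [derivative_intros] =
  bounded_bilinear.FDERIV[OF bounded_bilinear_vector_scalar_mult]
lemmas tendsto_vector_scalar_mult [tendsto_intros] =
  bounded_bilinear.tendsto[OF bounded_bilinear_vector_scalar_mult]

lemma complex_linear_imp_matrix:
  fixes D :: "complex^'d \<Rightarrow> complex^'d"
  assumes "\<And>x y. D (x + y) = D x + D y" and "\<And>c x. D (c *s x) = c *s D x"
  obtains A :: "complex^'d^'d" where "\<And>x. D x = A *v x"
proof -
  have "Vector_Spaces.linear (*s) (*s) D"
    by (simp add: assms linear_iff_module_hom module_hom_iff vec.module_axioms)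
  then have "matrix D *v x = D x" for x
    by (rule matrix_works)
  then show ?thesis by (metis that)
qed

lemma complex_linear_sum:
  fixes D :: "complex^'d \<Rightarrow> 'b::comm_ring"
  assumes "\<And>x y. D (x + y) = D x + D y" and "D 0 = 0"
  shows "D (\<Sum>i\<in>S. g i) = (\<Sum>i\<in>S. D (g i))"
  by (induction S rule: infinite_finite_induct) (auto simp: assms)

text \<open>Gram-Schmidt in coordinates: a linear isomorphism onto \<open>G\<close> from the standard Hermitian form. An
  orthonormal family indexed by a proper subset of the coordinates can be enlarged, since the
  conditions of orthogonality to it are fewer than the coordinates.\<close>

lemma hermitian_form_isometry:
  fixes G :: "complex^'d \<Rightarrow> complex^'d \<Rightarrow> complex"
  assumes add: "\<And>x y z. G (x + y) z = G x z + G y z"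
    and scale: "\<And>c x z. G (c *s x) z = c * G x z"
    and herm: "\<And>x y. G y x = cnj (G x y)"
    and pos: "\<And>x. x \<noteq> 0 \<Longrightarrow> 0 < Re (G x x)"
  obtains V W :: "complex^'d^'d"
  where "V ** W = mat 1" and "W ** V = mat 1"
    and "\<And>x. Re (G (V *v x) (V *v x)) = (norm x)\<^sup>2"
proof -
  have G0: "G 0 z = 0" for z using scale[of 0 0 z] by simp
  have scale2: "G x (c *s y) = cnj c * G x y" for c x y
    using herm scale by (metis complex_cnj_mult)
  have sumL: "G (\<Sum>i\<in>S. g i) z = (\<Sum>i\<in>S. G (g i) z)" for S z and g :: "'d \<Rightarrow> _"
    by (rule complex_linear_sum) (auto simp: add G0)
  have sumR: "G z (\<Sum>i\<in>S. g i) = (\<Sum>i\<in>S. G z (g i))" for S z and g :: "'d \<Rightarrow> _"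
    by (subst (1 2) herm) (simp add: sumL)
  have fam: "\<exists>b. \<forall>i\<in>F. \<forall>j\<in>F. G (b i) (b j) = (if i = j then 1 else 0)" for F :: "'d set"
  proof (induction F rule: finite_induct[OF finite])
    case 1
    show ?case by simp
  next
    case (2 k F)
    then obtain b where b: "\<And>i j. i \<in> F \<Longrightarrow> j \<in> F \<Longrightarrow> G (b i) (b j) = (if i = j then 1 else 0)"
      by blast
    define T where "T v = (\<chi> i. if i \<in> F then G v (b i) else 0)" for v :: "complex^'d"
    obtain A where A: "\<And>x. T x = A *v x"
      by (rule complex_linear_imp_matrix[of T]) (auto simp: T_def vec_eq_iff add scale)
    \<comment> \<open>The \<open>k\<close>-th component of \<open>T\<close> vanishes, so \<open>T\<close> is not onto, hence not injective.\<close>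
    have "\<not> (\<exists>B. A ** B = mat 1)"
    proof
      assume "\<exists>B. A ** B = mat 1"
      then obtain B where "A ** B = mat 1" by blast
      then have "T (B *v axis k 1) = axis k 1"
        by (simp add: A matrix_vector_mul_assoc)
      then have "T (B *v axis k 1) $ k = 1" by simp
      then show False using 2 by (simp add: T_def)
    qed
    then have "\<not> (\<exists>B. B ** A = mat 1)"
      by (simp add: matrix_left_right_inverse)
    then obtain v where v: "v \<noteq> 0" "T v = 0"
      unfolding matrix_left_invertible_ker A by blast
    define s where "s = sqrt (Re (G v v))"
    have s: "s > 0" using pos[OF v(1)] by (simp add: s_def)
    have Gvv: "G v v = of_real (s\<^sup>2)"
    proof -
      have "Im (G v v) = 0" using herm[of v v] by (metis cnj.simps(2) neg_equal_0_iff_equal neg_equal_iff_equal equal_neg_zero)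
      then show ?thesis using pos[OF v(1)] by (simp add: complex_eq_iff s_def)
    qed
    have Gvb: "G v (b i) = 0" if "i \<in> F" for i
      using v(2) that by (auto simp: T_def vec_eq_iff split: if_splits dest: spec[of _ i])
    define b' where "b' = b(k := complex_of_real (1 / s) *s v)"
    have "G (b' i) (b' j) = (if i = j then 1 else 0)" if "i \<in> insert k F" "j \<in> insert k F" for i j
    proof -
      have "G (b i) v = 0" if "i \<in> F" for i using Gvb[OF that] herm[of v "b i"] by simp
      then show ?thesis
        using that 2(2) s by (auto simp: b'_def b Gvb Gvv scale scale2 power2_eq_square)
    qed
    then show ?case by blast
  qed
  obtain b where "\<forall>i\<in>(UNIV :: 'd set). \<forall>j\<in>UNIV. G (b i) (b j) = (if i = j then 1 else 0)"
    using fam[of UNIV] by (rule exE)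
  then have b: "\<And>i j :: 'd. G (b i) (b j) = (if i = j then 1 else 0)" by simp
  obtain V where V: "\<And>x. (\<Sum>i\<in>UNIV. x $ i *s b i) = V *v x"
    by (rule complex_linear_imp_matrix[of "\<lambda>x. \<Sum>i\<in>UNIV. x $ i *s b i"])
       (auto simp: vec_eq_iff sum.distrib algebra_simps sum_distrib_left)
  have norm: "Re (G (V *v x) (V *v x)) = (norm x)\<^sup>2" for x
  proof -
    have "G (V *v x) (V *v x) = (\<Sum>i\<in>UNIV. \<Sum>j\<in>UNIV. x $ i * cnj (x $ j) * G (b i) (b j))"
      by (simp add: V[symmetric] sumL sumR scale scale2 sum_distrib_left algebra_simps)
        (rule sum.swap)
    also have "\<dots> = (\<Sum>i\<in>UNIV. x $ i * cnj (x $ i))"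
      by (simp add: b if_distrib cong: if_cong)
    finally show ?thesis
      by (simp add: complex_norm_square[symmetric] norm_vec_def L2_set_def sum_nonneg
          del: of_real_power)
  qed
  have "V *v x = 0 \<Longrightarrow> x = 0" for x
    using norm[of x] by (auto simp: G0)
  then obtain W where "W ** V = mat 1"
    unfolding matrix_left_invertible_ker[symmetric] by (metis matrix_left_invertible_ker)
  then show ?thesis using that norm matrix_left_right_inverse by blast
qed

section \<open>Quadratic model domains\<close>

lemma bounded_linear_complex_functional:
  fixes \<alpha> :: "complex^'d \<Rightarrow> complex"
  assumes "\<And>x y. \<alpha> (x + y) = \<alpha> x + \<alpha> y" and "\<And>c x. \<alpha> (c *s x) = c * \<alpha> x"
  shows "bounded_linear \<alpha>"
proof -
  have "linear \<alpha>"
    by (rule linearI) (simp_all add: assms scaleR_eq_vector_scalar_mult scaleR_conv_of_real)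
  then show ?thesis by (simp add: linear_conv_bounded_linear)
qed

lemma zero_if_multiples_bounded_above:
  fixes a b c :: real
  assumes "\<And>t. t * a \<le> c"
  shows "a = 0"
proof (rule ccontr)
  assume "a \<noteq> 0"
  then show False using assms[of "(c + 1) / a"] by simp
qed

text \<open>The sesquilinear part of a real bilinear form on \<open>C\<^sup>d\<close>, complex-linear in the first argument; for a
  real Hessian it is the Levi form.\<close>

definition hermitian_part ::
    "(complex^'d \<Rightarrow> complex^'d \<Rightarrow> real) \<Rightarrow> complex^'d \<Rightarrow> complex^'d \<Rightarrow> complex" where
  "hermitian_part H v w = (of_real (H v w + H (\<i> *s v) (\<i> *s w))
     + \<i> * of_real (H v (\<i> *s w) - H (\<i> *s v) w)) / 4"

lemma complex_scale_split:
  "c *s v = Re c *\<^sub>R v + Im c *\<^sub>R (\<i> *s v)" for c and v :: "complex^'d"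
  by (simp add: vec_eq_iff complex_eq_iff)

lemma i_times_i: "\<i> *s (\<i> *s v) = - v" for v :: "complex^'d"
  by (simp add: vec_eq_iff)

lemma i_times_add: "\<i> *s (x + y) = \<i> *s x + \<i> *s y"
  and i_times_scaleR: "\<i> *s (a *\<^sub>R x) = a *\<^sub>R (\<i> *s x)" for x y :: "complex^'d"
  by (simp_all add: vec_eq_iff algebra_simps)

lemma hermitian_part_sesquilinear:
  assumes "bounded_bilinear H"
  shows "hermitian_part H (x + y) z = hermitian_part H x z + hermitian_part H y z"
    and "hermitian_part H z (x + y) = hermitian_part H z x + hermitian_part H z y"
    and "hermitian_part H (c *s x) z = c * hermitian_part H x z"
    and "hermitian_part H z (c *s x) = cnj c * hermitian_part H z x"
proof -
  interpret bounded_bilinear H by fact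
  note H_simps = add_left add_right diff_left diff_right scaleR_left scaleR_right minus_left minus_right
    i_times_i i_times_add i_times_scaleR
  show "hermitian_part H (x + y) z = hermitian_part H x z + hermitian_part H y z"
    and "hermitian_part H z (x + y) = hermitian_part H z x + hermitian_part H z y"
    by (simp_all add: hermitian_part_def complex_eq_iff H_simps field_simps)
  show "hermitian_part H (c *s x) z = c * hermitian_part H x z"
    and "hermitian_part H z (c *s x) = cnj c * hermitian_part H z x"
    unfolding complex_scale_split[of c x]
    by (simp_all add: hermitian_part_def complex_eq_iff H_simps field_simps)
qed

text \<open>The data of the limit of the rescaled domains. The form \<open>\<alpha>\<close> is the complex differential of a
  defining function and \<open>H\<close> its real Hessian. The two sign conditions come from convexity and from
  strong pseudoconvexity; both concern only the complex tangent space \<open>\<alpha> = 0\<close>.\<close>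

locale quadratic_model =
  fixes \<alpha> :: "complex^'d \<Rightarrow> complex" and e :: "complex^'d"
    and H :: "complex^'d \<Rightarrow> complex^'d \<Rightarrow> real"
  assumes \<alpha>_add: "\<alpha> (x + y) = \<alpha> x + \<alpha> y"
    and \<alpha>_scale: "\<alpha> (c *s x) = c * \<alpha> x"
    and \<alpha>_e: "\<alpha> e = 1"
    and H: "bounded_bilinear H"
    and H_sym: "H x y = H y x"
    and H_nonneg: "\<alpha> u = 0 \<Longrightarrow> 0 \<le> H u u"
    and H_pos: "\<alpha> u = 0 \<Longrightarrow> u \<noteq> 0 \<Longrightarrow> 0 < H u u + H (\<i> *s u) (\<i> *s u)"
begin

definition P :: "complex^'d \<Rightarrow> complex^'d"
  where "P w = w - \<alpha> w *s e"

definition \<rho> :: "complex^'d \<Rightarrow> real"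
  where "\<rho> w = Re (\<alpha> w) + H (P w) (P w) / 2 - 1"

definition D :: "(complex^'d) set"
  where "D = {w. \<rho> w < 0}"

lemma bounded_linear_\<alpha>: "bounded_linear \<alpha>"
  using \<alpha>_add \<alpha>_scale by (rule bounded_linear_complex_functional)

lemmas \<alpha>_simps = \<alpha>_add \<alpha>_scale \<alpha>_e
  bounded_linear.linear[OF bounded_linear_\<alpha>, THEN linear_0]
  bounded_linear.linear[OF bounded_linear_\<alpha>, THEN linear_diff]
  bounded_linear.linear[OF bounded_linear_\<alpha>, THEN linear_neg]
  bounded_linear.linear[OF bounded_linear_\<alpha>, THEN linear_scale]

lemmas H_simps = bounded_bilinear.add_left[OF H] bounded_bilinear.add_right[OF H]
  bounded_bilinear.diff_left[OF H] bounded_bilinear.diff_right[OF H]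
  bounded_bilinear.scaleR_left[OF H] bounded_bilinear.scaleR_right[OF H]
  bounded_bilinear.minus_left[OF H] bounded_bilinear.minus_right[OF H]
  bounded_bilinear.zero_left[OF H] bounded_bilinear.zero_right[OF H]

lemma P_add: "P (x + y) = P x + P y"
  and P_scale: "P (c *s x) = c *s P x"
  and P_scaleR: "P (a *\<^sub>R x) = a *\<^sub>R P x"
  and P_diff: "P (x - y) = P x - P y"
  and P_0: "P 0 = 0"
  and P_e: "P e = 0"
  and \<alpha>_P: "\<alpha> (P w) = 0"
  and P_kernel: "\<alpha> u = 0 \<Longrightarrow> P u = u"
  by (simp_all add: P_def \<alpha>_simps vec_eq_iff algebra_simps)

lemma bounded_linear_P: "bounded_linear P"
proof -
  have "linear P"
    by (rule linearI) (simp_all add: P_add P_scaleR)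
  then show ?thesis by (simp add: linear_conv_bounded_linear)
qed

lemmas tendsto_\<alpha> [tendsto_intros] = bounded_linear.tendsto[OF bounded_linear_\<alpha>]
lemmas tendsto_P [tendsto_intros] = bounded_linear.tendsto[OF bounded_linear_P]
lemmas tendsto_H [tendsto_intros] = bounded_bilinear.tendsto[OF H]

lemma continuous_on_\<rho>: "continuous_on S \<rho>"
  unfolding \<rho>_def continuous_on_def by (auto intro!: tendsto_intros)

lemma \<rho>_0: "\<rho> 0 = -1"
  by (simp add: \<rho>_def \<alpha>_simps P_0 H_simps)

lemma \<rho>_convex_comb:
  assumes "0 \<le> t" "t \<le> 1"
  shows "\<rho> ((1 - t) *\<^sub>R x + t *\<^sub>R y) \<le> (1 - t) * \<rho> x + t * \<rho> y"
proof -
  have "(1 - t) * \<rho> x + t * \<rho> y - \<rho> ((1 - t) *\<^sub>R x + t *\<^sub>R y)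
      = t * (1 - t) * H (P (x - y)) (P (x - y)) / 2"
    by (simp add: \<rho>_def P_add P_diff P_scaleR H_simps \<alpha>_simps H_sym[of "P y" "P x"])
       (simp add: field_simps)
  moreover have "\<dots> \<ge> 0"
    using assms H_nonneg[OF \<alpha>_P, of "x - y"] by simp
  ultimately show ?thesis by linarith
qed

text \<open>Shrinking towards \<open>0\<close> decreases \<open>\<rho>\<close> by a definite amount. This absorbs the error when \<open>\<rho>\<close> is
  replaced by a function close to it.\<close>

lemma \<rho>_shrink:
  assumes "0 \<le> t" "t \<le> 1"
  shows "\<rho> (t *\<^sub>R w) \<le> t * \<rho> w - (1 - t)"
  using \<rho>_convex_comb[OF assms, of 0 w] by (simp add: \<rho>_0)

lemma zero_in_D: "0 \<in> D"
  by (simp add: D_def \<rho>_0)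

lemma convex_domain_D: "convex_domain D"
  unfolding convex_domain_def
proof (intro conjI)
  show "open D"
    unfolding D_def by (intro open_Collect_less continuous_on_\<rho> continuous_intros)
  show "convex D"
  proof (rule convexI)
    fix x y :: "complex^'d" and u v :: real
    assume *: "x \<in> D" "y \<in> D" "0 \<le> u" "0 \<le> v" "u + v = 1"
    then have "u = 1 - v" "v \<le> 1" by simp_all
    then have "\<rho> (u *\<^sub>R x + v *\<^sub>R y) \<le> u * \<rho> x + v * \<rho> y"
      using \<rho>_convex_comb[OF \<open>0 \<le> v\<close>, of x y] by (simp only:)
    also have "\<dots> < 0"
    proof (cases "u = 0")
      case True with * show ?thesis by (simp add: D_def)
    next
      case False
      with * have "u * \<rho> x < 0" "v * \<rho> y \<le> 0"
        by (auto simp: D_def mult_less_0_iff mult_le_0_iff)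
      then show ?thesis by linarith
    qed
    finally show "u *\<^sub>R x + v *\<^sub>R y \<in> D" by (simp add: D_def)
  qed
  show "D \<noteq> {}" using zero_in_D by blast
qed

lemma closure_D_subset: "closure D \<subseteq> {w. \<rho> w \<le> 0}"
  by (rule closure_minimal)
     (auto simp: D_def intro!: closed_Collect_le continuous_on_\<rho> continuous_intros)

text \<open>Along a complex line in \<open>D\<close> with direction \<open>v\<close>, the real part of \<open>\<alpha>\<close> is bounded above, so
  \<open>\<alpha> v = 0\<close>. Then the nonnegative form \<open>H\<close> is bounded along the line and has to vanish at \<open>v\<close> and at
  \<open>\<i> v\<close>, against strong pseudoconvexity.\<close>

lemma no_complex_line_in_D:
  assumes "complex_affine_line L"
  shows "\<not> L \<subseteq> D"
proof
  assume "L \<subseteq> D"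
  obtain p v where v: "v \<noteq> 0" and L: "L = range (\<lambda>t::complex. p + t *s v)"
    using assms unfolding complex_affine_line_def by blast
  have \<rho>: "\<rho> (p + t *s v) < 0" for t
    using \<open>L \<subseteq> D\<close> by (auto simp: L D_def)
  have bound: "Re (t * \<alpha> v) \<le> 1 - Re (\<alpha> p)" for t
    using \<rho>[of t] H_nonneg[OF \<alpha>_P, of "p + t *s v"] by (simp add: \<rho>_def \<alpha>_simps)
  have "(cmod (\<alpha> v))\<^sup>2 = 0"
  proof (rule zero_if_multiples_bounded_above)
    fix t :: real
    show "t * (cmod (\<alpha> v))\<^sup>2 \<le> 1 - Re (\<alpha> p)"
      unfolding cmod_power2 using bound[of "of_real t * cnj (\<alpha> v)"]
      by (simp add: algebra_simps power2_eq_square)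
  qed
  then have \<alpha>v: "\<alpha> v = 0" by simp
  have vanish: "H (c *s v) (c *s v) = 0" for c
  proof (rule zero_if_multiples_bounded_above)
    fix t :: real
    show "t * H (c *s v) (c *s v) \<le> 2 - 2 * Re (\<alpha> p)"
    proof (cases "t \<ge> 0")
      case True
      define s where "s = sqrt t"
      have ct: "P (p + (of_real a * c) *s v) = P p + a *\<^sub>R (c *s v)" for a
        by (simp add: P_add P_kernel \<alpha>v \<alpha>_simps scaleR_eq_vector_scalar_mult)
      have "H (P p + s *\<^sub>R (c *s v)) (P p + s *\<^sub>R (c *s v)) \<le> 2 - 2 * Re (\<alpha> p)"
        and "H (P p + (- s) *\<^sub>R (c *s v)) (P p + (-s) *\<^sub>R (c *s v)) \<le> 2 - 2 * Re (\<alpha> p)"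
        using \<rho>[of "of_real s * c"] \<rho>[of "of_real (- s) * c"] unfolding \<rho>_def ct
        by (simp_all add: \<alpha>_simps \<alpha>v)
      \<comment> \<open>The parallelogram identity removes the terms linear in \<open>s\<close>.\<close>
      moreover have "H (P p + s *\<^sub>R x) (P p + s *\<^sub>R x) + H (P p + (-s) *\<^sub>R x) (P p + (-s) *\<^sub>R x)
          = 2 * H (P p) (P p) + 2 * ((s * s) * H x x)" for x
        by (simp add: H_simps algebra_simps)
      moreover have "H (P p) (P p) \<ge> 0" by (rule H_nonneg[OF \<alpha>_P])
      moreover have "s * s = t" using True by (simp add: s_def)
      ultimately show ?thesis by (smt (verit))
    next
      case False
      then have "t * H (c *s v) (c *s v) \<le> 0"
        using H_nonneg[of "c *s v"] by (simp add: \<alpha>_simps \<alpha>v mult_le_0_iff)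
      then show ?thesis using bound[of 0] by simp
    qed
  qed
  show False
    using H_pos[OF \<alpha>v v] vanish[of 1] vanish[of \<i>] by simp
qed

lemma D_in_\<X>\<^sub>0: "(D, 0) \<in> \<X>\<^sub>0"
  using convex_domain_D no_complex_line_in_D zero_in_D by (auto simp: \<X>\<^sub>0_def \<X>_def)

abbreviation "levi \<equiv> hermitian_part H"

text \<open>The complex bilinear part of the Hessian. The real part of its quadratic form is pluriharmonic, and
  it makes up the difference between half the Hessian and the Levi form.\<close>

definition pluriharmonic :: "complex^'d \<Rightarrow> complex^'d \<Rightarrow> complex" where
  "pluriharmonic v w = (of_real (H v w - H (\<i> *s v) (\<i> *s w))
     - \<i> * of_real (H v (\<i> *s w) + H (\<i> *s v) w)) / 4"

lemmas levi_add = hermitian_part_sesquilinear(1)[OF H]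
lemmas levi_scale = hermitian_part_sesquilinear(3)[OF H]

lemma levi_hermitian: "levi y x = cnj (levi x y)"
  by (simp add: hermitian_part_def complex_eq_iff H_sym[of x y] H_sym[of "\<i> *s x" y]
      H_sym[of x "\<i> *s y"] H_sym[of "\<i> *s x" "\<i> *s y"])

lemma levi_pos: "\<alpha> u = 0 \<Longrightarrow> u \<noteq> 0 \<Longrightarrow> 0 < Re (levi u u)"
  using H_pos by (simp add: hermitian_part_def)

lemma pluriharmonic_add: "pluriharmonic (x + y) z = pluriharmonic x z + pluriharmonic y z"
  by (simp add: pluriharmonic_def H_simps complex_eq_iff i_times_add i_times_scaleR field_simps)

lemma pluriharmonic_scale: "pluriharmonic (c *s x) z = c * pluriharmonic x z"
  by (subst complex_scale_split)
     (simp add: pluriharmonic_def H_simps complex_eq_iff i_times_add i_times_scaleR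
        i_times_i algebra_simps)

lemma pluriharmonic_sym: "pluriharmonic y x = pluriharmonic x y"
  by (simp add: pluriharmonic_def complex_eq_iff H_sym[of x y] H_sym[of "\<i> *s x" y]
      H_sym[of x "\<i> *s y"] H_sym[of "\<i> *s x" "\<i> *s y"])

lemma H_decomposition: "H u u / 2 = Re (levi u u) + Re (pluriharmonic u u)"
  by (simp add: hermitian_part_def pluriharmonic_def field_simps)

end

section \<open>Holomorphic maps and biholomorphisms\<close>

lemma holomorphic_map_onI:
  fixes \<phi> :: "complex^'d \<Rightarrow> complex^'d"
  assumes "\<And>z. z \<in> S \<Longrightarrow> (\<phi> has_derivative D z) (at z)"
    and "\<And>z x y. z \<in> S \<Longrightarrow> D z (x + y) = D z x + D z y"
    and "\<And>z c x. z \<in> S \<Longrightarrow> D z (c *s x) = c *s D z x"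
  shows "holomorphic_map_on \<phi> S"
  unfolding holomorphic_map_on_def
proof
  fix z assume z: "z \<in> S"
  obtain A where "\<And>x. D z x = A *v x"
    by (rule complex_linear_imp_matrix[of "D z"]) (use assms(2,3)[OF z] in auto)
  then have "D z = (*v) A" by (rule ext)
  then show "\<exists>A. (\<phi> has_derivative (*v) A) (at z)"
    using assms(1)[OF z] by metis
qed

lemma has_derivative_matrix_vector_mult:
  fixes A :: "complex^'d^'d"
  shows "(((*v) A) has_derivative (*v) A) (at z)"
proof -
  have "linear ((*v) A)"
    by (rule linearI) (simp_all add: matrix_vector_right_distrib vector_scalar_commute
        scaleR_eq_vector_scalar_mult)
  then show ?thesis
    by (simp add: linear_conv_bounded_linear bounded_linear_imp_has_derivative)
qed

lemma holomorphic_map_on_compose: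
  assumes "holomorphic_map_on \<phi> S" "holomorphic_map_on \<psi> T" "\<phi> ` S \<subseteq> T"
  shows "holomorphic_map_on (\<psi> \<circ> \<phi>) S"
  unfolding holomorphic_map_on_def
proof
  fix z assume z: "z \<in> S"
  obtain A where A: "(\<phi> has_derivative (*v) A) (at z)"
    using assms(1) z unfolding holomorphic_map_on_def by blast
  obtain B where B: "(\<psi> has_derivative (*v) B) (at (\<phi> z))"
    using assms(2,3) z unfolding holomorphic_map_on_def by blast
  have "((\<psi> \<circ> \<phi>) has_derivative (*v) (B ** A)) (at z)"
    using diff_chain_at[OF A B] by (simp add: o_def matrix_vector_mul_assoc)
  then show "\<exists>C. ((\<psi> \<circ> \<phi>) has_derivative (*v) C) (at z)" by blast
qed

lemma biholomorphismI:
  assumes "holomorphic_map_on \<phi> S" "holomorphic_map_on \<psi> T"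
    and "\<And>z. z \<in> S \<Longrightarrow> \<phi> z \<in> T \<and> \<psi> (\<phi> z) = z"
    and "\<And>w. w \<in> T \<Longrightarrow> \<psi> w \<in> S \<and> \<phi> (\<psi> w) = w"
  shows "biholomorphism \<phi> S T"
  unfolding biholomorphism_def
  using assms by (auto intro!: bij_betw_byWitness[where f' = \<psi>] exI[of _ \<psi>])

section \<open>The model domain and the ball\<close>

context quadratic_model
begin

lemma bounded_bilinear_pluriharmonic: "bounded_bilinear pluriharmonic"
proof -
  have "linear (\<lambda>x. pluriharmonic x y)" "linear (\<lambda>x. pluriharmonic y x)" for y
    unfolding pluriharmonic_sym[of y]
    by (auto intro!: linearI simp: pluriharmonic_add pluriharmonic_scale
        scaleR_eq_vector_scalar_mult scaleR_conv_of_real)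
  then have "bilinear pluriharmonic"
    by (simp add: bilinear_def)
  then show ?thesis by (simp add: bilinear_conv_bounded_bilinear)
qed

lemma pluriharmonic_add2: "pluriharmonic z (x + y) = pluriharmonic z x + pluriharmonic z y"
  by (metis pluriharmonic_sym pluriharmonic_add)
lemma pluriharmonic_scale2: "pluriharmonic z (c *s x) = c * pluriharmonic z x"
  by (metis pluriharmonic_sym pluriharmonic_scale)

lemmas has_derivative_pluriharmonic [derivative_intros] =
  bounded_bilinear.FDERIV[OF bounded_bilinear_pluriharmonic]
lemmas has_derivative_\<alpha> [derivative_intros] =
  bounded_linear.has_derivative[OF bounded_linear_\<alpha>]
lemmas has_derivative_P [derivative_intros] =
  bounded_linear.has_derivative[OF bounded_linear_P]

lemmas complex_linear_simps = \<alpha>_add \<alpha>_scale P_add P_scale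
  pluriharmonic_add pluriharmonic_scale pluriharmonic_add2 pluriharmonic_scale2

text \<open>The shear that absorbs the pluriharmonic part: in terms of \<open>\<zeta> = normal_coordinate w\<close> and \<open>u = P w\<close>
  the model domain is the Siegel domain \<open>Re \<zeta> + levi u u < 1\<close>.\<close>

definition normal_coordinate :: "complex^'d \<Rightarrow> complex"
  where "normal_coordinate w = \<alpha> w + pluriharmonic (P w) (P w)"

text \<open>The shear followed by the Cayley transform of the Siegel domain, in the coordinates
  \<open>- \<zeta> / (2 - \<zeta>)\<close> along \<open>e\<close> and \<open>2 u / (2 - \<zeta>)\<close> in the kernel of \<open>\<alpha>\<close>. The identity
  \<open>\<bar>2 - \<zeta>\<bar>\<^sup>2 - \<bar>\<zeta>\<bar>\<^sup>2 = 4 - 4 Re \<zeta>\<close> makes its image the unit ball of \<open>\<bar>\<alpha> y\<bar>\<^sup>2 + levi (P y) (P y)\<close>.\<close>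

definition cayley :: "complex^'d \<Rightarrow> complex^'d"
  where "cayley w = inverse (2 - normal_coordinate w) *s (2 *s P w - normal_coordinate w *s e)"

definition cayley_inv :: "complex^'d \<Rightarrow> complex^'d"
  where "cayley_inv y = (let c = inverse (1 - \<alpha> y); u = c *s P y
    in u + (- 2 * \<alpha> y * c - pluriharmonic u u) *s e)"

definition hermitian_norm2 :: "complex^'d \<Rightarrow> real"
  where "hermitian_norm2 y = (cmod (\<alpha> y))\<^sup>2 + Re (levi (P y) (P y))"

definition hermitian_ball :: "(complex^'d) set"
  where "hermitian_ball = {y. hermitian_norm2 y < 1}"

lemma levi_scale_both: "levi (c *s u) (c *s u) = of_real ((cmod c)\<^sup>2) * levi u u"
proof -
  have "levi u (c *s u) = cnj c * levi u u"
    by (metis levi_hermitian levi_scale complex_cnj_mult)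
  then show ?thesis by (simp add: levi_scale complex_norm_square del: of_real_power)
qed

lemma levi_kernel_nonneg: "\<alpha> u = 0 \<Longrightarrow> 0 \<le> Re (levi u u)"
  using levi_pos[of u] levi_scale[of 0 u u] by (cases "u = 0") (auto simp: less_imp_le)

lemma \<rho>_normal_coordinate:
  "\<rho> w = Re (normal_coordinate w) + Re (levi (P w) (P w)) - 1"
  by (simp add: \<rho>_def normal_coordinate_def H_decomposition)

lemma normal_coordinate_D: "w \<in> D \<Longrightarrow> normal_coordinate w \<noteq> 2"
  using levi_kernel_nonneg[OF \<alpha>_P, of w] by (auto simp: D_def \<rho>_normal_coordinate)

lemma \<alpha>_hermitian_ball: "y \<in> hermitian_ball \<Longrightarrow> cmod (\<alpha> y) < 1"
proof -
  assume "y \<in> hermitian_ball"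
  then have "(cmod (\<alpha> y))\<^sup>2 < 1"
    using levi_kernel_nonneg[OF \<alpha>_P, of y] by (simp add: hermitian_ball_def hermitian_norm2_def)
  then show ?thesis by (simp add: abs_square_less_1)
qed

lemma \<alpha>_hermitian_ball': "y \<in> hermitian_ball \<Longrightarrow> \<alpha> y \<noteq> 1"
  using \<alpha>_hermitian_ball[of y] by auto

lemma holomorphic_cayley: "holomorphic_map_on cayley D"
proof (rule holomorphic_map_onI)
  fix w assume "w \<in> D"
  show "(cayley has_derivative (\<lambda>v.
      let n = normal_coordinate w;
          n' = \<alpha> v + (pluriharmonic (P w) (P v) + pluriharmonic (P v) (P w))
      in inverse (2 - n) *s (2 *s P v - n' *s e)
        + (inverse (2 - n) * n' * inverse (2 - n)) *s (2 *s P w - n *s e))) (at w)"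
    unfolding cayley_def normal_coordinate_def Let_def
    using normal_coordinate_D[OF \<open>w \<in> D\<close>, unfolded normal_coordinate_def]
    by (auto intro!: derivative_eq_intros simp: vec_eq_iff algebra_simps)
qed (simp_all add: Let_def complex_linear_simps vec_eq_iff algebra_simps)

lemma holomorphic_cayley_inv: "holomorphic_map_on cayley_inv hermitian_ball"
proof (rule holomorphic_map_onI)
  fix y assume "y \<in> hermitian_ball"
  show "(cayley_inv has_derivative (\<lambda>v.
      let c = inverse (1 - \<alpha> y); c' = c * \<alpha> v * c; u = c *s P y; u' = c *s P v + c' *s P y
      in u' + (- 2 * \<alpha> v * c - 2 * \<alpha> y * c' - (pluriharmonic u u' + pluriharmonic u' u)) *s e)) (at y)"
    unfolding cayley_inv_def Let_def
    using \<alpha>_hermitian_ball'[OF \<open>y \<in> hermitian_ball\<close>]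
    by (auto intro!: derivative_eq_intros simp: vec_eq_iff algebra_simps)
qed (simp_all add: Let_def complex_linear_simps vec_eq_iff algebra_simps)

lemma cayley_simps:
  assumes "normal_coordinate w \<noteq> 2"
  shows "\<alpha> (cayley w) = - normal_coordinate w / (2 - normal_coordinate w)"
    and "P (cayley w) = (2 / (2 - normal_coordinate w)) *s P w"
  by (simp_all add: cayley_def \<alpha>_simps P_scale P_diff P_e P_kernel[OF \<alpha>_P] \<alpha>_P vec_eq_iff field_simps)

lemma cayley_in_hermitian_ball:
  assumes "w \<in> D"
  shows "cayley w \<in> hermitian_ball"
proof -
  define n where "n = normal_coordinate w"
  have n: "n \<noteq> 2" using normal_coordinate_D[OF assms] by (simp add: n_def)
  have "hermitian_norm2 (cayley w) * (cmod (2 - n))\<^sup>2 = (cmod n)\<^sup>2 + 4 * Re (levi (P w) (P w))"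
    using n unfolding hermitian_norm2_def cayley_simps[OF n[unfolded n_def]] n_def[symmetric]
    by (simp add: levi_scale_both norm_divide power_divide field_simps)
  also have "\<dots> < (cmod (2 - n))\<^sup>2"
    using assms unfolding cmod_power2
    by (simp add: D_def \<rho>_normal_coordinate n_def[symmetric] power2_eq_square algebra_simps)
  finally show ?thesis
    using n by (simp add: hermitian_ball_def)
qed

lemma cayley_inv_simps:
  assumes "\<alpha> y \<noteq> 1"
  shows "P (cayley_inv y) = inverse (1 - \<alpha> y) *s P y"
    and "normal_coordinate (cayley_inv y) = - 2 * \<alpha> y / (1 - \<alpha> y)"
proof -
  show P: "P (cayley_inv y) = inverse (1 - \<alpha> y) *s P y"
    unfolding cayley_inv_def Let_def P_add P_scale P_e P_kernel[OF \<alpha>_P] by simp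
  show "normal_coordinate (cayley_inv y) = - 2 * \<alpha> y / (1 - \<alpha> y)"
    unfolding normal_coordinate_def P
    by (simp add: cayley_inv_def Let_def \<alpha>_simps \<alpha>_P divide_inverse)
qed

lemma cayley_inv_in_D:
  assumes "y \<in> hermitian_ball"
  shows "cayley_inv y \<in> D"
proof -
  have y: "1 - \<alpha> y \<noteq> 0" using \<alpha>_hermitian_ball'[OF assms] by simp
  define m where "m = (cmod (1 - \<alpha> y))\<^sup>2"
  have m: "m > 0" using y by (simp add: m_def)
  have "Re (- 2 * \<alpha> y / (1 - \<alpha> y)) = Re (- 2 * \<alpha> y * cnj (1 - \<alpha> y)) / m"
    unfolding m_def by (subst complex_div_cnj) (simp only: Re_divide_of_real)
  then have "Re (- 2 * \<alpha> y / (1 - \<alpha> y)) * m = Re (- 2 * \<alpha> y * cnj (1 - \<alpha> y))"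
    using m by (metis nonzero_eq_divide_eq less_irrefl)
  then have "Re (- 2 * \<alpha> y / (1 - \<alpha> y)) * m = 2 * (cmod (\<alpha> y))\<^sup>2 - 2 * Re (\<alpha> y)"
    by (rule trans) (unfold cmod_power2, simp add: power2_eq_square algebra_simps)
  moreover have "Re (levi (P (cayley_inv y)) (P (cayley_inv y))) * m = Re (levi (P y) (P y))"
    using m \<alpha>_hermitian_ball'[OF assms]
    by (simp add: cayley_inv_simps levi_scale_both m_def norm_inverse power_inverse norm_divide
        power_divide field_simps)
  ultimately have "\<rho> (cayley_inv y) * m = 2 * (cmod (\<alpha> y))\<^sup>2 - 2 * Re (\<alpha> y) + Re (levi (P y) (P y)) - m"
    using \<alpha>_hermitian_ball'[OF assms] by (simp add: \<rho>_normal_coordinate cayley_inv_simps(2) algebra_simps)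
  also have "\<dots> = hermitian_norm2 y - 1"
    unfolding m_def hermitian_norm2_def cmod_power2 by (simp add: power2_eq_square algebra_simps)
  also have "\<dots> < 0" using assms by (simp add: hermitian_ball_def)
  finally show ?thesis using m by (simp add: D_def mult_less_0_iff)
qed

lemma split_along_e: "P w + \<alpha> w *s e = w"
  by (simp add: P_def)

lemma eq_from_\<alpha>_P: "\<alpha> x = \<alpha> y \<Longrightarrow> P x = P y \<Longrightarrow> x = y"
  by (metis split_along_e)

lemma eq_from_normal_coordinate_P:
  assumes "normal_coordinate x = normal_coordinate y" and P: "P x = P y"
  shows "x = y"
  by (rule eq_from_\<alpha>_P[OF _ P]) (use assms(1) in \<open>simp add: normal_coordinate_def P\<close>)

lemma cayley_inverses:
  shows "w \<in> D \<Longrightarrow> cayley_inv (cayley w) = w"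
    and "y \<in> hermitian_ball \<Longrightarrow> cayley (cayley_inv y) = y"
proof -
  assume w: "w \<in> D"
  define n where "n = normal_coordinate w"
  have n: "2 - n \<noteq> 0" using normal_coordinate_D[OF w] by (simp add: n_def)
  have 1: "1 - \<alpha> (cayley w) = 2 / (2 - n)"
    using n normal_coordinate_D[OF w] by (simp add: cayley_simps n_def[symmetric] field_simps)
  then have ne: "\<alpha> (cayley w) \<noteq> 1" using n by auto
  have "P (cayley_inv (cayley w)) = (inverse (2 / (2 - n)) * (2 / (2 - n))) *s P w"
    unfolding cayley_inv_simps[OF ne] 1 cayley_simps(2)[OF normal_coordinate_D[OF w]]
    by (simp add: n_def)
  also have "inverse (2 / (2 - n)) * (2 / (2 - n)) = 1"
    using n by (intro left_inverse) simp
  finally have PP: "P (cayley_inv (cayley w)) = P w"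
    by simp
  have nn: "normal_coordinate (cayley_inv (cayley w)) = n"
    using n normal_coordinate_D[OF w]
    unfolding cayley_inv_simps[OF ne] 1 by (simp add: cayley_simps n_def[symmetric])
  show "cayley_inv (cayley w) = w"
    using nn PP unfolding n_def by (rule eq_from_normal_coordinate_P)
next
  assume y: "y \<in> hermitian_ball"
  have y1: "1 - \<alpha> y \<noteq> 0" using \<alpha>_hermitian_ball'[OF y] by simp
  have y1': "\<alpha> y \<noteq> 1" using \<alpha>_hermitian_ball'[OF y] by simp
  have 2: "2 - normal_coordinate (cayley_inv y) = 2 / (1 - \<alpha> y)"
    using y1 by (simp add: cayley_inv_simps[OF y1'] field_simps)
  then have ne: "normal_coordinate (cayley_inv y) \<noteq> 2" using y1 by auto
  show "cayley (cayley_inv y) = y"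
  proof (rule eq_from_\<alpha>_P)
    have "- (- 2 * a / b) / (2 / b) = a" if "b \<noteq> 0" for a b :: complex
      using that by simp
    from this[OF y1, of "\<alpha> y"] show "\<alpha> (cayley (cayley_inv y)) = \<alpha> y"
      unfolding cayley_simps(1)[OF ne] 2 unfolding cayley_inv_simps(2)[OF y1'] .
    have "2 / (2 / b) * inverse b = 1" if "b \<noteq> 0" for b :: complex
      using that by simp
    from this[OF y1] show "P (cayley (cayley_inv y)) = P y"
      unfolding cayley_simps(2)[OF ne] 2 cayley_inv_simps(1)[OF y1'] by simp
  qed
qed

theorem biholomorphic_to_ball:
  obtains \<phi> where "biholomorphism \<phi> D (ball 0 1)" and "\<phi> 0 = 0"
proof -
  define G where "G x y = \<alpha> x * cnj (\<alpha> y) + levi (P x) (P y)" for x y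
  have G: "Re (G x x) = hermitian_norm2 x" for x
    by (simp add: G_def hermitian_norm2_def complex_norm_square[symmetric] del: of_real_power)
  have G_add: "G (x + y) z = G x z + G y z" and G_scale: "G (c *s x) z = c * G x z" for c x y z
    by (simp_all add: G_def \<alpha>_simps P_add P_scale levi_add levi_scale algebra_simps)
  have G_herm: "G y x = cnj (G x y)" for x y
    using levi_hermitian[of "P y" "P x"] by (simp add: G_def)
  have "0 < Re (G x x)" if "x \<noteq> 0" for x
  proof (cases "\<alpha> x = 0")
    case True
    then show ?thesis
      using that levi_pos[OF True] by (simp add: G hermitian_norm2_def P_kernel)
  next
    case False
    then have "0 < (cmod (\<alpha> x))\<^sup>2" by simp
    then show ?thesis
      using levi_kernel_nonneg[OF \<alpha>_P, of x] by (simp only: G hermitian_norm2_def add_pos_nonneg)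
  qed
  then have "\<exists>V W :: complex^'d^'d. V ** W = mat 1 \<and> W ** V = mat 1 \<and>
      (\<forall>x. Re (G (V *v x) (V *v x)) = (norm x)\<^sup>2)"
    by (metis hermitian_form_isometry[of G] G_add G_scale G_herm)
  then obtain V W :: "complex^'d^'d" where VW: "V ** W = mat 1" "W ** V = mat 1"
      and norm: "\<And>x. Re (G (V *v x) (V *v x)) = (norm x)\<^sup>2"
    by blast
  have VW': "V *v (W *v x) = x" "W *v (V *v x) = x" for x
    by (simp_all add: matrix_vector_mul_assoc VW)
  have ball: "V *v x \<in> hermitian_ball \<longleftrightarrow> norm x < 1" for x
    using norm[of x] by (simp add: G hermitian_ball_def abs_square_less_1)
  have W: "norm (W *v y) < 1" if "y \<in> hermitian_ball" for y
    using ball[of "W *v y"] that by (simp add: VW')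
  have hol: "holomorphic_map_on ((*v) A) S" for A :: "complex^'d^'d" and S
    unfolding holomorphic_map_on_def using has_derivative_matrix_vector_mult by blast
  have "biholomorphism ((*v) W \<circ> cayley) D (ball 0 1)"
  proof (rule biholomorphismI)
    show "holomorphic_map_on ((*v) W \<circ> cayley) D"
      by (rule holomorphic_map_on_compose[OF holomorphic_cayley hol[of W UNIV]]) simp
    show "holomorphic_map_on (cayley_inv \<circ> (*v) V) (ball 0 1)"
      by (rule holomorphic_map_on_compose[OF hol holomorphic_cayley_inv]) (auto simp: ball)
  qed (simp_all add: cayley_in_hermitian_ball cayley_inv_in_D cayley_inverses W VW' ball)
  moreover have "((*v) W \<circ> cayley) 0 = 0"
    by (simp add: cayley_def normal_coordinate_def \<alpha>_simps P_0 pluriharmonic_def H_simps)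
  ultimately show ?thesis by (rule that)
qed

end

section \<open>Local Hausdorff convergence\<close>

text \<open>Multiplication by \<open>t < 1\<close> moves points of the ball of radius \<open>R\<close> by at most \<open>(1 - t) R\<close> and maps the
  ball to itself. So it suffices that, for each \<open>t\<close>, it eventually carries the truncations of the two
  sets into one another; this also avoids trouble at the sphere where the sets are cut off.\<close>

lemma local_hausdorff_convergesI:
  fixes A :: "nat \<Rightarrow> 'a::real_normed_vector set"
  assumes "\<And>R t. 0 < t \<Longrightarrow> t < 1 \<Longrightarrow> \<forall>\<^sub>F n in sequentially.
      (\<forall>w\<in>closure (A n) \<inter> cball 0 R. t *\<^sub>R w \<in> closure B) \<and>
      (\<forall>w\<in>closure B \<inter> cball 0 R. t *\<^sub>R w \<in> closure (A n))"
  shows "local_hausdorff_converges A B"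
  unfolding local_hausdorff_converges_def
proof (intro exI[of _ 0] conjI allI impI)
  fix R :: real assume "0 \<le> R"
  show "(\<lambda>n. local_hausdorff_distance R (closure (A n)) (closure B)) \<longlonglongrightarrow> 0"
  proof (rule order_tendstoI)
    fix a :: ennreal assume "0 < a"
    then obtain b where "0 < b" "b < a" using dense by blast
    then obtain \<epsilon> where \<epsilon>: "0 < \<epsilon>" "ennreal \<epsilon> < a"
      by (cases b) (auto simp: top_unique less_top[symmetric])
    define t where "t = 1 - min (1 / 2) (\<epsilon> / (R + 1))"
    have t: "0 < t" "t < 1" using \<epsilon>(1) \<open>0 \<le> R\<close> by (auto simp: t_def min_def)
    have "(1 - t) * R \<le> \<epsilon> / (R + 1) * R"
      using \<open>0 \<le> R\<close> by (intro mult_right_mono) (auto simp: t_def)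
    also have "\<dots> \<le> \<epsilon>" using \<open>0 \<le> R\<close> \<epsilon>(1) by (simp add: field_simps)
    finally have tR: "(1 - t) * R \<le> \<epsilon>" .
    have half: "(SUP a\<in>X \<inter> cball 0 R. INF b\<in>Y \<inter> cball 0 R. ennreal (dist a b)) \<le> ennreal \<epsilon>"
      if XY: "\<forall>w\<in>X \<inter> cball 0 R. t *\<^sub>R w \<in> Y" for X Y :: "'a set"
    proof (rule SUP_least)
      fix w assume w: "w \<in> X \<inter> cball 0 R"
      have "norm (t *\<^sub>R w) \<le> R"
        using w t mult_mono[of t 1 "norm w" R] by simp
      then have "t *\<^sub>R w \<in> Y \<inter> cball 0 R" using XY w by simp
      moreover have "dist w (t *\<^sub>R w) \<le> \<epsilon>"
      proof -
        have "w - t *\<^sub>R w = (1 - t) *\<^sub>R w" by (simp add: algebra_simps)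
        then have "dist w (t *\<^sub>R w) = (1 - t) * norm w" using t by (simp add: dist_norm)
        also have "\<dots> \<le> (1 - t) * R" using w t by (intro mult_left_mono) auto
        finally show ?thesis using tR by linarith
      qed
      ultimately show "(INF b\<in>Y \<inter> cball 0 R. ennreal (dist w b)) \<le> ennreal \<epsilon>"
        by (intro INF_lower2[of "t *\<^sub>R w"] ennreal_leI)
    qed
    show "\<forall>\<^sub>F n in sequentially. local_hausdorff_distance R (closure (A n)) (closure B) < a"
      using assms[OF t, of R]
    proof (rule eventually_mono)
      fix n
      assume n: "(\<forall>w\<in>closure (A n) \<inter> cball 0 R. t *\<^sub>R w \<in> closure B) \<and>
        (\<forall>w\<in>closure B \<inter> cball 0 R. t *\<^sub>R w \<in> closure (A n))"
      have "local_hausdorff_distance R (closure (A n)) (closure B) \<le> ennreal \<epsilon>"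
        unfolding local_hausdorff_distance_def hausdorff_distance_def
        using half[of "closure (A n)" "closure B"] half[of "closure B" "closure (A n)"] n
        by (simp add: dist_commute)
      then show "local_hausdorff_distance R (closure (A n)) (closure B) < a"
        using \<epsilon>(2) by (rule le_less_trans)
    qed
  qed simp
qed simp

text \<open>Convergence jointly in the parameter and the point is uniform on compact sets. Joint limits are
  convenient below because they follow from the usual rules for limits of composite expressions.\<close>

lemma compact_uniform_of_joint_tendsto:
  fixes f :: "'a \<Rightarrow> 'b::topological_space \<Rightarrow> 'c::metric_space"
  assumes K: "compact K"
    and lim: "\<And>w. w \<in> K \<Longrightarrow> ((\<lambda>p. f (fst p) (snd p)) \<longlongrightarrow> g w) (F \<times>\<^sub>F nhds w)"
    and g: "\<And>w. w \<in> K \<Longrightarrow> (g \<longlongrightarrow> g w) (nhds w)"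
    and \<epsilon>: "0 < \<epsilon>"
  shows "\<forall>\<^sub>F z in F. \<forall>w\<in>K. dist (f z w) (g w) < \<epsilon>"
proof -
  have "\<exists>Q S. eventually Q F \<and> open S \<and> w \<in> S \<and> (\<forall>z v. Q z \<longrightarrow> v \<in> S \<longrightarrow> dist (f z v) (g v) < \<epsilon>)"
    if w: "w \<in> K" for w
  proof -
    have "\<forall>\<^sub>F p in F \<times>\<^sub>F nhds w. dist (f (fst p) (snd p)) (g w) < \<epsilon> / 2"
      using tendstoD[OF lim[OF w], of "\<epsilon> / 2"] \<epsilon> by simp
    then obtain Q Q' where Q: "eventually Q F" "eventually Q' (nhds w)"
        "\<And>z v. Q z \<Longrightarrow> Q' v \<Longrightarrow> dist (f z v) (g w) < \<epsilon> / 2"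
      unfolding eventually_prod_filter by auto
    have "\<forall>\<^sub>F v in nhds w. Q' v \<and> dist (g v) (g w) < \<epsilon> / 2"
      using tendstoD[OF g[OF w], of "\<epsilon> / 2"] \<epsilon> Q(2) by (simp add: eventually_conj)
    then obtain S where S: "open S" "w \<in> S" "\<And>v. v \<in> S \<Longrightarrow> Q' v \<and> dist (g v) (g w) < \<epsilon> / 2"
      unfolding eventually_nhds by blast
    have "dist (f z v) (g v) < \<epsilon>" if "Q z" "v \<in> S" for z v
      using Q(3)[of z v] S(3)[of v] that by (auto intro: dist_triangle_half_l)
    then show ?thesis using Q(1) S(1,2) by blast
  qed
  then obtain Q S where QS: "\<And>w. w \<in> K \<Longrightarrow> eventually (Q w) F" "\<And>w. w \<in> K \<Longrightarrow> open (S w)"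
      "\<And>w. w \<in> K \<Longrightarrow> w \<in> S w"
      "\<And>w z v. w \<in> K \<Longrightarrow> Q w z \<Longrightarrow> v \<in> S w \<Longrightarrow> dist (f z v) (g v) < \<epsilon>"
    by metis
  obtain C where C: "C \<subseteq> K" "finite C" "K \<subseteq> (\<Union>w\<in>C. S w)"
    using compactE_image[OF K, of K S] QS(2,3) by blast
  have "\<forall>\<^sub>F z in F. \<forall>w\<in>C. Q w z"
    using C QS(1) by (auto simp: eventually_ball_finite_distrib)
  then show ?thesis
    by (rule eventually_mono) (use C QS(4) in blast)
qed

section \<open>Second-order Taylor expansion and the Levi form\<close>

text \<open>The Lagrange form of the remainder along a segment. It leaves the second derivative at an
  intermediate point, where continuity compares it with the value at a limit point.\<close>

lemma taylor_second_order:
  fixes r :: "'a::real_normed_vector \<Rightarrow> real"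
  assumes "\<And>x. x \<in> U \<Longrightarrow> (r has_derivative blinfun_apply (r' x)) (at x)"
    and "\<And>x. x \<in> U \<Longrightarrow> (r' has_derivative blinfun_apply (r'' x)) (at x)"
    and "\<And>s. 0 \<le> s \<Longrightarrow> s \<le> 1 \<Longrightarrow> z + s *\<^sub>R h \<in> U"
  shows "\<exists>s. 0 < s \<and> s < 1 \<and> r (z + h) = r z + r' z h + r'' (z + s *\<^sub>R h) h h / 2"
proof -
  define diff where "diff m s = (if m = 0 then r (z + s *\<^sub>R h)
     else if m = 1 then r' (z + s *\<^sub>R h) h else r'' (z + s *\<^sub>R h) h h)" for m :: nat and s
  have line: "((\<lambda>s. z + s *\<^sub>R h) has_derivative (\<lambda>s. s *\<^sub>R h)) (at s)" for s
    by (auto intro!: derivative_eq_intros)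
  have "DERIV (diff m) s :> diff (Suc m) s" if "m < 2" "0 \<le> s" "s \<le> 1" for m s
  proof (cases "m = 0")
    case True
    have "((\<lambda>s. r (z + s *\<^sub>R h)) has_derivative (\<lambda>t. r' (z + s *\<^sub>R h) (t *\<^sub>R h))) (at s)"
      using diff_chain_at[OF line assms(1)[OF assms(3)[OF that(2,3)]]] by (simp add: o_def)
    then show ?thesis
      unfolding diff_def True has_field_derivative_def
      by (simp add: blinfun.scaleR_right mult.commute[of _ "blinfun_apply _ _"])
  next
    case False
    then have m: "m = 1" using that by simp
    have "((\<lambda>s. r' (z + s *\<^sub>R h)) has_derivative (\<lambda>t. r'' (z + s *\<^sub>R h) (t *\<^sub>R h))) (at s)"
      using diff_chain_at[OF line assms(2)[OF assms(3)[OF that(2,3)]]] by (simp add: o_def)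
    then have "((\<lambda>s. r' (z + s *\<^sub>R h) h) has_derivative (\<lambda>t. r'' (z + s *\<^sub>R h) (t *\<^sub>R h) h)) (at s)"
      by (auto intro!: derivative_eq_intros simp: blinfun.zero_right)
    then show ?thesis
      unfolding diff_def m has_field_derivative_def
      by (simp add: blinfun.scaleR_right blinfun.scaleR_left mult.commute[of _ "blinfun_apply _ _"])
  qed
  moreover have "diff 0 = (\<lambda>s. r (z + s *\<^sub>R h))"
    by (rule ext) (simp add: diff_def)
  ultimately obtain s where "0 < s" "s < 1"
      "r (z + 1 *\<^sub>R h) = (\<Sum>m<2. diff m 0 / fact m * 1 ^ m) + diff 2 s / fact 2 * 1 ^ 2"
    using Maclaurin[of 1 2 diff "\<lambda>s. r (z + s *\<^sub>R h)"] by auto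
  then show ?thesis
    by (intro exI[of _ s]) (simp add: diff_def numeral_2_eq_2)
qed

text \<open>Twice the holomorphic differential \<open>\<partial>r\<close>: the complex-linear form with real part \<open>r' z\<close>.\<close>

definition complex_differential ::
    "(complex^'d \<Rightarrow> (complex^'d) \<Rightarrow>\<^sub>L real) \<Rightarrow> complex^'d \<Rightarrow> complex^'d \<Rightarrow> complex"
  where "complex_differential r' z v = of_real (r' z v) - \<i> * of_real (r' z (\<i> *s v))"

lemma complex_differential_add:
  "complex_differential r' z (x + y) = complex_differential r' z x + complex_differential r' z y"
  by (simp add: complex_differential_def i_times_add blinfun.add_right algebra_simps)

lemma complex_differential_diff:
  "complex_differential r' z (x - y) = complex_differential r' z x - complex_differential r' z y"
  using complex_differential_add[of r' z "x - y" y] by (simp add: algebra_simps)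

lemma complex_differential_scale:
  "complex_differential r' z (c *s x) = c * complex_differential r' z x"
  unfolding complex_scale_split[of c x]
  by (simp add: complex_differential_def i_times_add i_times_scaleR i_times_i blinfun.add_right blinfun.scaleR_right
      blinfun.minus_right blinfun.diff_right complex_eq_iff)

lemma complex_linear_axis_sum:
  fixes D :: "complex^'d \<Rightarrow> complex"
  assumes "\<And>x y. D (x + y) = D x + D y" and "\<And>c x. D (c *s x) = c * D x"
  shows "D v = (\<Sum>j\<in>UNIV. D (axis j 1) * v $ j)"
proof -
  have "D v = D (\<Sum>j\<in>UNIV. v $ j *s axis j 1)" by (simp add: basis_expansion)
  also have "\<dots> = (\<Sum>j\<in>UNIV. D (v $ j *s axis j 1))"
    using assms(2)[of 0 0] by (intro complex_linear_sum) (simp_all add: assms(1))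
  finally show ?thesis by (simp add: assms(2) mult.commute)
qed

lemma i_axis: "\<i> *s axis j 1 = (axis j \<i> :: complex^'d)"
  by (simp add: vec_eq_iff axis_def)

context
  fixes U :: "(complex^'d) set" and r :: "complex^'d \<Rightarrow> real"
    and r' :: "complex^'d \<Rightarrow> (complex^'d) \<Rightarrow>\<^sub>L real"
    and r'' :: "complex^'d \<Rightarrow> (complex^'d) \<Rightarrow>\<^sub>L ((complex^'d) \<Rightarrow>\<^sub>L real)"
  assumes U: "open U"
    and r': "\<And>x. x \<in> U \<Longrightarrow> (r has_derivative blinfun_apply (r' x)) (at x)"
    and r'': "\<And>x. x \<in> U \<Longrightarrow> (r' has_derivative blinfun_apply (r'' x)) (at x)"
begin

lemma frechet_derivative_of_real_comp:
  "z \<in> U \<Longrightarrow> frechet_derivative (\<lambda>w. complex_of_real (r w)) (at z) v = of_real (r' z v)"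
  using frechet_derivative_at[OF has_derivative_of_real[OF r'], of z] by metis

lemma wirtinger_complex_differential:
  "z \<in> U \<Longrightarrow> wirtinger j (\<lambda>w. complex_of_real (r w)) z = complex_differential r' z (axis j 1) / 2"
  by (simp add: wirtinger_def frechet_derivative_of_real_comp complex_differential_def i_axis)

lemma complex_tangent_eq:
  assumes "z \<in> U"
  shows "complex_tangent r z = {v. complex_differential r' z v = 0}"
proof -
  have "complex_differential r' z v =
      2 * (\<Sum>j\<in>UNIV. wirtinger j (\<lambda>w. complex_of_real (r w)) z * v $ j)" for v
    by (subst complex_linear_axis_sum)
       (simp_all add: complex_differential_add complex_differential_scale
          wirtinger_complex_differential[OF assms] sum_distrib_left)
  then show ?thesis by (simp add: complex_tangent_def)
qed

lemma wirtinger_second: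
  assumes z: "z \<in> U"
  shows "wirtinger j (wirtinger_bar k (\<lambda>w. complex_of_real (r w))) z
    = hermitian_part (\<lambda>v. blinfun_apply (r'' z v)) (axis j 1) (axis k 1)"
proof -
  have eq: "(of_real (r' w (axis k 1)) + \<i> * of_real (r' w (axis k \<i>))) / 2 =
      wirtinger_bar k (\<lambda>w. complex_of_real (r w)) w" if "w \<in> U" for w
    by (simp add: wirtinger_bar_def frechet_derivative_of_real_comp[OF that])
  have apply_deriv: "((\<lambda>w. complex_of_real (r' w a)) has_derivative (\<lambda>v. of_real (r'' z v a))) (at z)" for a
    using r''[OF z] by (auto intro!: derivative_eq_intros simp: blinfun.zero_right)
  have "((\<lambda>w. (of_real (r' w (axis k 1)) + \<i> * of_real (r' w (axis k \<i>))) / 2) has_derivative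
      (\<lambda>v. (of_real (r'' z v (axis k 1)) + \<i> * of_real (r'' z v (axis k \<i>))) / 2)) (at z)"
    by (intro bounded_linear.has_derivative[OF bounded_linear_divide] has_derivative_add
        has_derivative_mult_right apply_deriv)
  then have "(wirtinger_bar k (\<lambda>w. complex_of_real (r w)) has_derivative
      (\<lambda>v. (of_real (r'' z v (axis k 1)) + \<i> * of_real (r'' z v (axis k \<i>))) / 2)) (at z)"
    by (rule has_derivative_transform_within_open[OF _ U z eq])
  from frechet_derivative_at[OF this, symmetric] show ?thesis
    by (simp add: wirtinger_def hermitian_part_def i_axis complex_eq_iff field_simps)
qed

text \<open>The Levi form and the Hermitian part of the second derivative extend to sesquilinear forms in two
  vectors, and these agree on coordinate vectors by the computation of Wirtinger derivatives.\<close>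

lemma Re_levi_form:
  assumes z: "z \<in> U"
  shows "Re (levi_form r z v) = (r'' z v v + r'' z (\<i> *s v) (\<i> *s v)) / 4"
proof -
  define B where "B = hermitian_part (\<lambda>v. blinfun_apply (r'' z v))"
  have bil: "bounded_bilinear (\<lambda>v. blinfun_apply (r'' z v))"
    by (rule bounded_bilinear.comp1[OF bounded_bilinear_blinfun_apply blinfun.bounded_linear_right])
  note B = hermitian_part_sesquilinear[OF bil, folded B_def]
  have "B v v = (\<Sum>j\<in>UNIV. B (axis j 1) v * v $ j)"
    by (rule complex_linear_axis_sum) (simp_all add: B)
  also have "\<dots> = (\<Sum>j\<in>UNIV. \<Sum>k\<in>UNIV. B (axis j 1) (axis k 1) * v $ j * cnj (v $ k))"
  proof (rule sum.cong[OF refl])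
    fix j
    have "cnj (B (axis j 1) v) = (\<Sum>k\<in>UNIV. cnj (B (axis j 1) (axis k 1)) * v $ k)"
      by (rule complex_linear_axis_sum) (simp_all add: B)
    then have "B (axis j 1) v = (\<Sum>k\<in>UNIV. B (axis j 1) (axis k 1) * cnj (v $ k))"
      by (metis (no_types, lifting) cnj_sum complex_cnj_cnj complex_cnj_mult sum.cong)
    then show "B (axis j 1) v * v $ j = (\<Sum>k\<in>UNIV. B (axis j 1) (axis k 1) * v $ j * cnj (v $ k))"
      by (simp add: sum_distrib_left mult_ac)
  qed
  finally have "levi_form r z v = B v v"
    by (simp add: levi_form_def wirtinger_second[OF z] B_def)
  then have "Re (levi_form r z v) = Re (B v v)" by simp
  then show ?thesis by (simp add: B_def hermitian_part_def)
qed

end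

section \<open>Rescaling at a strongly pseudoconvex point\<close>

lemma bounded_convex_domain_in_\<X>:
  fixes \<Omega> :: "(complex^'d) set"
  assumes "convex_domain \<Omega>" "bounded \<Omega>"
  shows "\<Omega> \<in> \<X>"
proof -
  have False if L: "complex_affine_line L" "L \<subseteq> \<Omega>" for L
  proof -
    obtain p v where v: "v \<noteq> 0" and Lpv: "L = range (\<lambda>t::complex. p + t *s v)"
      using L(1) unfolding complex_affine_line_def by blast
    obtain B where B: "\<And>x. x \<in> \<Omega> \<Longrightarrow> norm x \<le> B"
      using assms(2) unfolding bounded_iff by blast
    define t where "t = (B + norm p + 1) / norm v"
    have B0: "norm p \<le> B" using B[of p] L(2) by (auto simp: Lpv image_subset_iff dest: spec[of _ 0])
    have "p + of_real t *s v \<in> \<Omega>" using L(2) Lpv by blast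
    then have "norm (of_real t *s v) \<le> B + norm p"
      using B norm_triangle_ineq4[of "p + of_real t *s v" p] by fastforce
    moreover have "norm (of_real t *s v) = B + norm p + 1"
    proof -
      have "0 \<le> B" using B0 norm_ge_zero[of p] by linarith
      then have "0 \<le> t" by (simp add: t_def)
      then have "norm (of_real t *s v) = t * norm v" by (simp add: norm_vector_scalar_mult)
      then show ?thesis using v by (simp add: t_def)
    qed
    ultimately show False by simp
  qed
  then show ?thesis using assms(1) by (auto simp: \<X>_def)
qed

locale strongly_pseudoconvex_point =
  fixes \<Omega> U :: "(complex^'d) set" and \<xi> e :: "complex^'d"
    and r :: "complex^'d \<Rightarrow> real"
    and r' :: "complex^'d \<Rightarrow> (complex^'d) \<Rightarrow>\<^sub>L real"
    and r'' :: "complex^'d \<Rightarrow> (complex^'d) \<Rightarrow>\<^sub>L ((complex^'d) \<Rightarrow>\<^sub>L real)"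
  assumes U: "open U" "\<xi> \<in> U"
    and r': "\<And>x. x \<in> U \<Longrightarrow> (r has_derivative blinfun_apply (r' x)) (at x)"
    and r'': "\<And>x. x \<in> U \<Longrightarrow> (r' has_derivative blinfun_apply (r'' x)) (at x)"
    and r''_continuous: "continuous_on U r''"
    and inside: "\<Omega> \<inter> U = {z \<in> U. r z < 0}"
    and boundary: "frontier \<Omega> \<inter> U = {z \<in> U. r z = 0}" "\<xi> \<in> frontier \<Omega>"
    and domain: "convex_domain \<Omega>" "bounded \<Omega>"
    and e: "complex_differential r' \<xi> e = 1"
    and levi_positive: "\<And>v. complex_differential r' \<xi> v = 0 \<Longrightarrow> v \<noteq> 0 \<Longrightarrow>
        0 < r'' \<xi> v v + r'' \<xi> (\<i> *s v) (\<i> *s v)"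
begin

abbreviation "\<alpha> \<equiv> complex_differential r'"

text \<open>Symmetrised, so that its two complex parts are Hermitian and symmetric; the expansion of \<open>r\<close> sees the
  diagonal.\<close>

definition H :: "complex^'d \<Rightarrow> complex^'d \<Rightarrow> real"
  where "H v w = (r'' \<xi> v w + r'' \<xi> w v) / 2"

lemma r_\<xi>: "r \<xi> = 0"
  using U boundary by blast

lemma r'_tendsto: "(r' \<longlongrightarrow> r' \<xi>) (nhds \<xi>)"
  using has_derivative_continuous[OF r''[OF U(2)]] by (simp add: isCont_def tendsto_at_iff_tendsto_nhds)

lemma r_tendsto: "(r \<longlongrightarrow> 0) (nhds \<xi>)"
proof -
  have "(r \<longlongrightarrow> r \<xi>) (nhds \<xi>)"
    using has_derivative_continuous[OF r'[OF U(2)]]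
    by (simp add: isCont_def tendsto_at_iff_tendsto_nhds)
  then show ?thesis by (simp add: r_\<xi>)
qed

lemma r''_tendsto: "(r'' \<longlongrightarrow> r'' \<xi>) (nhds \<xi>)"
  using continuous_on_eq_continuous_at[OF U(1)] r''_continuous U(2)
  by (auto simp: isCont_def tendsto_at_iff_tendsto_nhds)

text \<open>If \<open>H u u < 0\<close> for a tangent vector \<open>u\<close>, the expansion of \<open>r\<close> puts \<open>\<xi> + s u\<close> and \<open>\<xi> - s u\<close> into \<open>\<Omega>\<close> for
  small \<open>s\<close>, and with them their midpoint \<open>\<xi>\<close>, which is a boundary point.\<close>

lemma H_nonneg:
  assumes u: "\<alpha> \<xi> u = 0"
  shows "0 \<le> H u u"
proof (rule ccontr)
  assume "\<not> 0 \<le> H u u"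
  then have neg: "r'' \<xi> u u < 0" by (simp add: H_def)
  have "((\<lambda>x. r'' x u u) \<longlongrightarrow> r'' \<xi> u u) (nhds \<xi>)"
    by (intro tendsto_intros r''_tendsto)
  then have "\<forall>\<^sub>F x in nhds \<xi>. r'' x u u < 0 \<and> x \<in> U"
    using neg U by (auto intro!: eventually_conj order_tendstoD eventually_nhds_in_open)
  then obtain d where d: "d > 0" "\<And>x. dist x \<xi> < d \<Longrightarrow> r'' x u u < 0 \<and> x \<in> U"
    unfolding eventually_nhds_metric by blast
  have pos: "norm u + 1 > 0" using norm_ge_zero[of u] by linarith
  define s where "s = d / 2 / (norm u + 1)"
  have s: "s > 0" using d(1) pos by (simp add: s_def)
  have su: "s * norm u < d"
  proof -
    have "s * norm u \<le> s * (norm u + 1)" using s by simp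
    also have "\<dots> = d / 2" unfolding s_def using pos
      by (subst times_divide_eq_left) (rule nonzero_mult_div_cancel_right, simp)
    finally show ?thesis using d(1) by linarith
  qed
  have in_\<Omega>: "\<xi> + a *\<^sub>R u \<in> \<Omega>" if a: "\<bar>a\<bar> = s" for a
  proof -
    have near: "dist (\<xi> + c *\<^sub>R (a *\<^sub>R u)) \<xi> < d" if "0 \<le> c" "c \<le> 1" for c
    proof -
      have "c * (s * norm u) \<le> 1 * (s * norm u)"
        using that s by (intro mult_right_mono) auto
      then show ?thesis using su a that by (simp add: dist_norm abs_mult mult.assoc)
    qed
    obtain c where c: "0 < c" "c < 1" "r (\<xi> + a *\<^sub>R u) = r \<xi> + r' \<xi> (a *\<^sub>R u)
        + r'' (\<xi> + c *\<^sub>R (a *\<^sub>R u)) (a *\<^sub>R u) (a *\<^sub>R u) / 2"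
      using taylor_second_order[of U r r' r'' \<xi> "a *\<^sub>R u"] r' r'' near d(2) by blast
    have "r' \<xi> u = 0"
      using arg_cong[OF u, of Re] by (simp add: complex_differential_def)
    then have "r (\<xi> + a *\<^sub>R u) = a\<^sup>2 * r'' (\<xi> + c *\<^sub>R (a *\<^sub>R u)) u u / 2"
      by (simp add: c(3) r_\<xi> blinfun.scaleR_left blinfun.scaleR_right power2_eq_square)
    also have "\<dots> < 0"
      using d(2)[OF near[of c]] c(1,2) a s by (auto simp: mult_less_0_iff)
    finally show ?thesis using inside d(2)[OF near[of 1]] by auto
  qed
  have "convex \<Omega>" "open \<Omega>" using domain by (simp_all add: convex_domain_def)
  have "(1/2) *\<^sub>R (\<xi> + s *\<^sub>R u) + (1/2) *\<^sub>R (\<xi> + (- s) *\<^sub>R u) \<in> \<Omega>"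
    using in_\<Omega>[of s] in_\<Omega>[of "- s"] s by (intro convexD[OF \<open>convex \<Omega>\<close>]) auto
  also have "(1/2) *\<^sub>R (\<xi> + s *\<^sub>R u) + (1/2) *\<^sub>R (\<xi> + (- s) *\<^sub>R u) = \<xi>"
    by (simp add: algebra_simps flip: scaleR_left.add)
  finally show False
    using boundary(2) \<open>open \<Omega>\<close> by (simp add: frontier_def interior_open)
qed

sublocale quadratic_model "\<alpha> \<xi>" e H
proof (rule quadratic_model.intro)
  show "\<alpha> \<xi> (x + y) = \<alpha> \<xi> x + \<alpha> \<xi> y" for x y by (rule complex_differential_add)
  show "\<alpha> \<xi> (c *s x) = c * \<alpha> \<xi> x" for c x by (rule complex_differential_scale)
  show "\<alpha> \<xi> e = 1" by (rule e)
  show "bounded_bilinear H"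
  proof -
    have bil: "bounded_bilinear (\<lambda>v. blinfun_apply (r'' \<xi> v))"
      by (rule bounded_bilinear.comp1[OF bounded_bilinear_blinfun_apply blinfun.bounded_linear_right])
    have "bilinear H"
      unfolding bilinear_def H_def
      by (auto intro!: linearI simp: blinfun.add_left blinfun.add_right blinfun.scaleR_left
          blinfun.scaleR_right field_simps)
    then show ?thesis by (simp add: bilinear_conv_bounded_bilinear)
  qed
  show "H x y = H y x" for x y by (simp add: H_def)
  show "\<alpha> \<xi> u = 0 \<Longrightarrow> 0 \<le> H u u" for u by (rule H_nonneg)
  show "\<alpha> \<xi> u = 0 \<Longrightarrow> u \<noteq> 0 \<Longrightarrow> 0 < H u u + H (\<i> *s u) (\<i> *s u)" for u
    using levi_positive by (simp add: H_def)
qed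

text \<open>The linear part \<open>M z\<close> of the inverse of the zoom at \<open>z\<close>. It sends \<open>e\<close> to \<open>(- r z) e\<close>, and a vector in the
  kernel of \<open>\<alpha> \<xi>\<close> to \<open>sqrt (- r z)\<close> times its projection along \<open>e\<close> to the kernel of \<open>\<alpha> z\<close>, where \<open>r\<close> has no
  term of order \<open>sqrt (- r z)\<close>. One factor \<open>sqrt (- r z)\<close> is split off so that the quotient \<open>N z\<close> has
  the limit \<open>P\<close>.\<close>

definition N :: "complex^'d \<Rightarrow> complex^'d \<Rightarrow> complex^'d"
  where "N z w = sqrt (- r z) *\<^sub>R (\<alpha> \<xi> w *s e) + (P w - (\<alpha> z (P w) / \<alpha> z e) *s e)"

definition M :: "complex^'d \<Rightarrow> complex^'d \<Rightarrow> complex^'d"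
  where "M z w = sqrt (- r z) *\<^sub>R N z w"

definition scaled_domain :: "complex^'d \<Rightarrow> (complex^'d) set"
  where "scaled_domain z = {w. z + M z w \<in> \<Omega>}"

definition scaled_function :: "complex^'d \<Rightarrow> complex^'d \<Rightarrow> real"
  where "scaled_function z w = r (z + M z w) / (- r z)"

lemma M_add: "M z (x + y) = M z x + M z y"
  and M_scale: "M z (c *s x) = c *s M z x"
  by (simp_all add: M_def N_def P_add P_scale complex_differential_add complex_differential_scale
      scaleR_eq_vector_scalar_mult vec_eq_iff add_divide_distrib algebra_simps)

text \<open>\<open>M z\<close> is a dilation followed by a shear along \<open>e\<close>, which \<open>P\<close> undoes. Where \<open>\<alpha> z e = 0\<close>, division by
  zero makes the shear vanish.\<close>

lemma M_kernel:
  assumes "r z < 0" "M z w = 0"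
  shows "w = 0"
proof -
  have N: "N z w = 0" using assms by (simp add: M_def)
  have "P (N z w) = P w"
    by (simp add: N_def P_add P_diff P_scale P_scaleR P_e P_kernel[OF \<alpha>_P])
  then have P: "P w = 0" using N by (simp add: P_0)
  then have "\<alpha> \<xi> (N z w) = sqrt (- r z) *\<^sub>R \<alpha> \<xi> w"
    using complex_differential_scale[of r' z 0 0]
    by (simp add: N_def \<alpha>_simps)
  then have "\<alpha> \<xi> w = 0" using N assms(1) by (simp add: \<alpha>_simps)
  then show ?thesis using P by (intro eq_from_\<alpha>_P[of w 0]) (simp_all add: P_0 \<alpha>_simps)
qed

lemma M_matrix:
  assumes "r z < 0"
  obtains A B :: "complex^'d^'d"
  where "\<And>w. M z w = A *v w" and "A ** B = mat 1" and "B ** A = mat 1"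
proof -
  obtain A where A: "\<And>w. M z w = A *v w"
    using complex_linear_imp_matrix[of "M z"] M_add M_scale by blast
  then obtain B where "B ** A = mat 1"
    using M_kernel[OF assms] by (metis matrix_left_invertible_ker)
  then show ?thesis using that A matrix_left_right_inverse by blast
qed

lemma biholomorphism_scaled_domain:
  assumes "r z < 0"
  obtains \<phi> where "biholomorphism \<phi> \<Omega> (scaled_domain z)" and "\<phi> z = 0"
    and "bounded (scaled_domain z)"
proof -
  obtain A B where AB: "\<And>w. M z w = A *v w" "A ** B = mat 1" "B ** A = mat 1"
    using M_matrix[OF assms] by blast
  define \<phi> where "\<phi> x = B *v (x - z)" for x
  define \<psi> where "\<psi> w = z + A *v w" for w
  have inv: "\<psi> (\<phi> x) = x" "\<phi> (\<psi> w) = w" for x w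
    by (simp_all add: \<phi>_def \<psi>_def matrix_vector_mul_assoc AB)
  have lin: "bounded_linear ((*v) C)" for C :: "complex^'d^'d"
    using has_derivative_matrix_vector_mult has_derivative_bounded_linear by blast
  have "(\<phi> has_derivative (*v) B) (at x)" "(\<psi> has_derivative (*v) A) (at x)" for x
    unfolding \<phi>_def \<psi>_def
    by (auto intro!: derivative_eq_intros bounded_linear.has_derivative[OF lin])
  then have hol: "holomorphic_map_on \<phi> S" "holomorphic_map_on \<psi> S" for S
    unfolding holomorphic_map_on_def by blast+
  have \<psi>: "\<psi> w \<in> \<Omega> \<longleftrightarrow> w \<in> scaled_domain z" for w
    by (simp add: scaled_domain_def \<psi>_def AB)
  have bih: "biholomorphism \<phi> \<Omega> (scaled_domain z)"
    by (rule biholomorphismI[where \<psi> = \<psi>]) (simp_all add: hol inv flip: \<psi>)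
  then have img: "scaled_domain z = \<phi> ` \<Omega>"
    by (simp add: biholomorphism_def bij_betw_def)
  have "\<phi> ` \<Omega> = (*v) B ` ((\<lambda>x. x - z) ` \<Omega>)"
    by (auto simp: \<phi>_def image_image)
  moreover have "bounded \<dots>"
    by (intro bounded_linear_image lin bounded_translation_minus domain)
  ultimately show ?thesis
    using that[OF bih] img by (simp add: \<phi>_def)
qed

lemma continuous_M: "continuous_on S (\<lambda>w. z + M z w)"
proof -
  have "linear (M z)"
    by (rule linearI) (simp_all add: M_add M_scale scaleR_eq_vector_scalar_mult)
  then have "bounded_linear (M z)" by (simp add: linear_conv_bounded_linear)
  then show ?thesis by (intro continuous_on_add continuous_on_const linear_continuous_on)
qed

lemma convex_domain_scaled_domain:
  assumes "z \<in> \<Omega>"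
  shows "convex_domain (scaled_domain z)" and "0 \<in> scaled_domain z"
proof -
  show 0: "0 \<in> scaled_domain z"
    using assms M_scale[of z 0 0] by (simp add: scaled_domain_def)
  have "open (scaled_domain z)"
    using continuous_open_vimage[of \<Omega> "\<lambda>w. z + M z w"] continuous_M[of UNIV z] domain(1)
    by (simp add: scaled_domain_def vimage_def convex_domain_def continuous_on_eq_continuous_at)
  moreover have "convex (scaled_domain z)"
  proof (rule convexI)
    fix x y and u v :: real
    assume *: "x \<in> scaled_domain z" "y \<in> scaled_domain z" "0 \<le> u" "0 \<le> v" "u + v = 1"
    have "z + M z (u *\<^sub>R x + v *\<^sub>R y) = (u + v) *\<^sub>R z + (u *\<^sub>R M z x + v *\<^sub>R M z y)"
      by (simp add: *(5) M_add M_scale scaleR_eq_vector_scalar_mult)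
    also have "\<dots> = u *\<^sub>R (z + M z x) + v *\<^sub>R (z + M z y)"
      by (simp add: algebra_simps)
    also have "\<dots> \<in> \<Omega>"
      using * domain(1) by (intro convexD) (auto simp: scaled_domain_def convex_domain_def)
    finally show "u *\<^sub>R x + v *\<^sub>R y \<in> scaled_domain z" by (simp add: scaled_domain_def)
  qed
  ultimately show "convex_domain (scaled_domain z)"
    using 0 by (auto simp: convex_domain_def)
qed

text \<open>From here to the limit of the rescaled functions, \<open>F\<close> describes pairs \<open>(z, w)\<close> with \<open>z \<rightarrow> \<xi>\<close> inside \<open>\<Omega>\<close>
  and \<open>w \<rightarrow> w0\<close>.\<close>

context
  fixes w0 :: "complex^'d" and F
  defines "F \<equiv> (at \<xi> within (\<Omega> \<inter> U)) \<times>\<^sub>F nhds w0"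
begin

lemma fst_F: "filterlim fst (nhds \<xi>) F"
  unfolding F_def by (rule filterlim_compose[OF _ filterlim_fst]) (simp add: filterlim_def at_within_def)

lemma snd_F: "filterlim snd (nhds w0) F"
  unfolding F_def by (rule filterlim_snd)

lemma r_neg_F: "\<forall>\<^sub>F p in F. fst p \<in> U \<and> r (fst p) < 0"
proof -
  have "\<forall>\<^sub>F z in at \<xi> within (\<Omega> \<inter> U). z \<in> U \<and> r z < 0"
    using inside by (auto simp: eventually_at_filter)
  then show ?thesis
    unfolding F_def by (rule eventually_compose_filterlim[OF _ filterlim_fst])
qed

lemma \<alpha>_F:
  assumes "(g \<longlongrightarrow> v) F"
  shows "((\<lambda>p. \<alpha> (fst p) (g p)) \<longlongrightarrow> \<alpha> \<xi> v) F"
  unfolding complex_differential_def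
  by (intro tendsto_intros assms filterlim_compose[OF r'_tendsto fst_F])

lemma N_F: "((\<lambda>p. N (fst p) (snd p)) \<longlongrightarrow> P w0) F"
proof -
  have "((\<lambda>p. N (fst p) (snd p)) \<longlongrightarrow>
      sqrt (- 0) *\<^sub>R (\<alpha> \<xi> w0 *s e) + (P w0 - (\<alpha> \<xi> (P w0) / \<alpha> \<xi> e) *s e)) F"
    unfolding N_def
    by (intro tendsto_intros \<alpha>_F snd_F filterlim_compose[OF r_tendsto fst_F]) (simp add: e)
  then show ?thesis by (simp add: \<alpha>_P)
qed

lemma M_F: "((\<lambda>p. M (fst p) (snd p)) \<longlongrightarrow> 0) F"
proof -
  have "((\<lambda>p. M (fst p) (snd p)) \<longlongrightarrow> sqrt (- 0) *\<^sub>R P w0) F"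
    unfolding M_def by (intro tendsto_intros N_F filterlim_compose[OF r_tendsto fst_F])
  then show ?thesis by simp
qed

lemma segment_F:
  "\<forall>\<^sub>F p in F. \<forall>s. 0 \<le> s \<longrightarrow> s \<le> 1 \<longrightarrow> fst p + s *\<^sub>R M (fst p) (snd p) \<in> U"
proof -
  obtain d where d: "d > 0" "ball \<xi> d \<subseteq> U" using U open_contains_ball by blast
  have "\<forall>\<^sub>F p in F. dist (fst p) \<xi> < d / 2" "\<forall>\<^sub>F p in F. dist (M (fst p) (snd p)) 0 < d / 2"
    using tendstoD[OF fst_F, of "d / 2"] tendstoD[OF M_F, of "d / 2"] d by simp_all
  then show ?thesis
  proof eventually_elim
    case (elim p)
    show ?case
    proof (intro allI impI)
      fix s :: real assume s: "0 \<le> s" "s \<le> 1"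
      have "dist (fst p + s *\<^sub>R M (fst p) (snd p)) \<xi> \<le> dist (fst p) \<xi> + norm (s *\<^sub>R M (fst p) (snd p))"
        using norm_triangle_ineq[of "fst p - \<xi>" "s *\<^sub>R M (fst p) (snd p)"]
        by (simp add: dist_norm algebra_simps)
      also have "norm (s *\<^sub>R M (fst p) (snd p)) \<le> norm (M (fst p) (snd p))"
        using s by (simp add: mult_left_le_one_le)
      finally have "dist (fst p + s *\<^sub>R M (fst p) (snd p)) \<xi> < d" using elim by simp
      then show "fst p + s *\<^sub>R M (fst p) (snd p) \<in> U"
        using d(2) by (auto simp: dist_commute)
    qed
  qed
qed

text \<open>In the Taylor expansion of \<open>r (z + M z w)\<close> at \<open>z\<close> each term is divisible by \<open>- r z\<close>: the first by
  itself, the second as \<open>\<alpha> z (M z w) = (- r z) * \<alpha> \<xi> w * \<alpha> z e\<close>, the third as \<open>M z = sqrt (- r z) N z\<close>.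
  The second derivative is evaluated at points tending to \<open>\<xi>\<close>, where it is continuous.\<close>

lemma scaled_function_F:
  "((\<lambda>p. scaled_function (fst p) (snd p)) \<longlongrightarrow> \<rho> w0) F"
proof -
  define R where "R p s \<longleftrightarrow> 0 < s \<and> s < 1 \<and> r (fst p + M (fst p) (snd p)) = r (fst p)
      + r' (fst p) (M (fst p) (snd p))
      + r'' (fst p + s *\<^sub>R M (fst p) (snd p)) (M (fst p) (snd p)) (M (fst p) (snd p)) / 2"
    for p :: "(complex^'d) \<times> (complex^'d)" and s :: real
  \<comment> \<open>The position of the intermediate point of the Lagrange remainder, as a function of \<open>(z, w)\<close>.\<close>
  define \<theta> where "\<theta> p = (SOME s. R p s)" for p
  have "\<forall>\<^sub>F p in F. \<exists>s. R p s"
    using segment_F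
  proof eventually_elim
    case (elim p)
    then show ?case
      unfolding R_def using taylor_second_order[of U r r' r'' "fst p" "M (fst p) (snd p)"] r' r'' by blast
  qed
  then have \<theta>: "\<forall>\<^sub>F p in F. R p (\<theta> p)"
    by eventually_elim (unfold \<theta>_def, rule someI_ex)
  have "((\<lambda>p. \<theta> p *\<^sub>R M (fst p) (snd p)) \<longlongrightarrow> 0) F"
  proof (rule Lim_null_comparison)
    show "\<forall>\<^sub>F p in F. norm (\<theta> p *\<^sub>R M (fst p) (snd p)) \<le> norm (M (fst p) (snd p))"
      using \<theta> by eventually_elim (simp add: R_def mult_left_le_one_le)
    show "((\<lambda>p. norm (M (fst p) (snd p))) \<longlongrightarrow> 0) F"
      using M_F by (rule tendsto_norm_zero)
  qed
  then have mid: "((\<lambda>p. fst p + \<theta> p *\<^sub>R M (fst p) (snd p)) \<longlongrightarrow> \<xi>) F"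
    using tendsto_add[OF fst_F] by fastforce
  have "((\<lambda>p. - 1 + Re (\<alpha> \<xi> (snd p) * \<alpha> (fst p) e)
      + r'' (fst p + \<theta> p *\<^sub>R M (fst p) (snd p)) (N (fst p) (snd p)) (N (fst p) (snd p)) / 2)
      \<longlongrightarrow> - 1 + Re (\<alpha> \<xi> w0 * \<alpha> \<xi> e) + r'' \<xi> (P w0) (P w0) / 2) F"
    by (intro tendsto_intros \<alpha>_F snd_F N_F filterlim_compose[OF r''_tendsto mid]) simp
  also have "- 1 + Re (\<alpha> \<xi> w0 * \<alpha> \<xi> e) + r'' \<xi> (P w0) (P w0) / 2 = \<rho> w0"
    by (simp add: \<rho>_def H_def e)
  finally show ?thesis
  proof (rule Lim_transform_eventually)
    have "\<forall>\<^sub>F p in F. \<alpha> (fst p) e \<noteq> 0"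
      using tendsto_imp_eventually_ne[OF \<alpha>_F[OF tendsto_const[of e]], of 0] e by simp
    with \<theta> r_neg_F
    show "\<forall>\<^sub>F p in F. - 1 + Re (\<alpha> \<xi> (snd p) * \<alpha> (fst p) e)
      + r'' (fst p + \<theta> p *\<^sub>R M (fst p) (snd p)) (N (fst p) (snd p)) (N (fst p) (snd p)) / 2
      = scaled_function (fst p) (snd p)"
    proof eventually_elim
      case (elim p)
      define z where "z = fst p"
      define w where "w = snd p"
      define t where "t = sqrt (- r z)"
      have t: "t > 0" "- r z = t * t" using elim by (simp_all add: t_def z_def)
      have M: "M z w = t *\<^sub>R N z w" by (simp add: M_def t_def)
      have "\<alpha> z (N z w) = of_real t * (\<alpha> \<xi> w * \<alpha> z e)"
        using elim(3) unfolding N_def t_def[symmetric] z_def[symmetric] scaleR_eq_vector_scalar_mult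
        by (simp add: complex_differential_add complex_differential_diff complex_differential_scale)
      moreover have "r' z (N z w) = Re (\<alpha> z (N z w))"
        by (simp add: complex_differential_def)
      ultimately have first: "r' z (N z w) = t * Re (\<alpha> \<xi> w * \<alpha> z e)"
        by (simp only: Re_complex_of_real Im_complex_of_real times_complex.simps)
      have "r (z + M z w) = - (t * t) + t * r' z (N z w)
          + (t * t) * (r'' (z + \<theta> p *\<^sub>R M z w) (N z w) (N z w) / 2)"
        using elim(1) t(2) unfolding R_def z_def[symmetric] w_def[symmetric]
        by (simp add: M blinfun.scaleR_left blinfun.scaleR_right)
      then have "r (z + M z w) = (t * t) * (- 1 + Re (\<alpha> \<xi> w * \<alpha> z e)
          + r'' (z + \<theta> p *\<^sub>R M z w) (N z w) (N z w) / 2)"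
        unfolding first by (simp only: distrib_left mult.assoc)
      then show ?case
        using t unfolding z_def[symmetric] w_def[symmetric] scaled_function_def by simp
    qed
  qed
qed

end

text \<open>On a ball both sets are sublevel sets, of functions that differ by less than \<open>1 - t\<close> when \<open>z\<close> is near
  \<open>\<xi>\<close>. Shrinking by \<open>t\<close> lowers \<open>\<rho>\<close> by enough to pass from either sublevel set to the other.\<close>

lemma scaled_converges:
  assumes z: "\<And>n. z n \<in> \<Omega> \<inter> U" and lim: "z \<longlonglongrightarrow> \<xi>"
  shows "local_hausdorff_converges (\<lambda>n. scaled_domain (z n)) D"
proof (rule local_hausdorff_convergesI)
  fix R t :: real assume t: "0 < t" "t < 1"
  define G where "G = at \<xi> within (\<Omega> \<inter> U)"
  obtain d where d: "d > 0" "ball \<xi> d \<subseteq> U" using U open_contains_ball by blast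
  have "z n \<noteq> \<xi>" for n using z[of n] inside r_\<xi> by auto
  then have zG: "filterlim z G sequentially"
    unfolding G_def filterlim_at using z lim by auto
  have "\<forall>\<^sub>F z in G. \<forall>w\<in>cball 0 R. dist (scaled_function z w) (\<rho> w) < 1 - t"
    unfolding G_def
  proof (rule compact_uniform_of_joint_tendsto[OF compact_cball scaled_function_F])
    show "(\<rho> \<longlongrightarrow> \<rho> w) (nhds w)" for w
      using continuous_on_\<rho>[of UNIV]
      by (simp add: continuous_on_eq_continuous_at isCont_def tendsto_at_iff_tendsto_nhds)
  qed (use t in simp)
  moreover have "\<forall>\<^sub>F z in G. \<forall>w\<in>cball 0 R. dist (z + M z w) \<xi> < d"
    unfolding G_def
  proof (rule compact_uniform_of_joint_tendsto[OF compact_cball])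
    show "((\<lambda>p. fst p + M (fst p) (snd p)) \<longlongrightarrow> \<xi>) ((at \<xi> within (\<Omega> \<inter> U)) \<times>\<^sub>F nhds w)" for w
      using tendsto_add[OF fst_F M_F] by simp
  qed (use d in auto)
  moreover have "\<forall>\<^sub>F z in G. r z < 0"
    using inside by (auto simp: G_def eventually_at_filter)
  ultimately have "\<forall>\<^sub>F z in G. (\<forall>w\<in>closure (scaled_domain z) \<inter> cball 0 R. t *\<^sub>R w \<in> closure D) \<and>
      (\<forall>w\<in>closure D \<inter> cball 0 R. t *\<^sub>R w \<in> closure (scaled_domain z))"
  proof eventually_elim
    case (elim z)
    have in_U: "z + M z w \<in> U" if "w \<in> cball 0 R" for w
      using elim(2) that d(2) by (auto simp: dist_commute)
    have "t *\<^sub>R w \<in> closure D" if w: "w \<in> closure (scaled_domain z)" "w \<in> cball 0 R" for w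
    proof -
      have "(\<lambda>w. z + M z w) ` closure (scaled_domain z) \<subseteq> closure \<Omega>"
        by (rule image_closure_subset[OF continuous_M closed_closure])
           (use closure_subset in \<open>auto simp: scaled_domain_def\<close>)
      then have "z + M z w \<in> (\<Omega> \<inter> U) \<union> (frontier \<Omega> \<inter> U)"
        using w in_U closure_Un_frontier[of \<Omega>] by blast
      then have "r (z + M z w) \<le> 0" unfolding inside boundary by auto
      then have "scaled_function z w \<le> 0"
        using elim(3) by (simp add: scaled_function_def zero_le_divide_iff)
      then have "\<rho> w < 1 - t" using elim(1) w(2) by (fastforce simp: dist_real_def)
      then have "t * \<rho> w < t * (1 - t)" using t by simp
      also have "\<dots> < 1 * (1 - t)" using t by (intro mult_strict_right_mono) auto
      finally have "\<rho> (t *\<^sub>R w) < 0" using \<rho>_shrink[of t w] t by simp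
      then have "t *\<^sub>R w \<in> D" by (simp add: D_def)
      then show ?thesis using closure_subset by blast
    qed
    moreover have "t *\<^sub>R w \<in> closure (scaled_domain z)" if w: "w \<in> closure D" "w \<in> cball 0 R" for w
    proof -
      have "\<rho> w \<le> 0" using w(1) closure_D_subset by blast
      then have "\<rho> (t *\<^sub>R w) \<le> - (1 - t)"
        using \<rho>_shrink[of t w] t mult_nonneg_nonpos[of t "\<rho> w"] by linarith
      moreover have tw: "t *\<^sub>R w \<in> cball 0 R"
        using w(2) t mult_mono[of t 1 "norm w" R] by simp
      ultimately have "scaled_function z (t *\<^sub>R w) < 0"
        using elim(1) by (fastforce simp: dist_real_def)
      then have "r (z + M z (t *\<^sub>R w)) < 0"
        using elim(3) by (simp add: scaled_function_def zero_less_divide_iff)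
      then have "t *\<^sub>R w \<in> scaled_domain z"
        using inside in_U[OF tw] by (auto simp: scaled_domain_def)
      then show ?thesis using closure_subset by blast
    qed
    ultimately show ?case by blast
  qed
  then show "\<forall>\<^sub>F n in sequentially.
      (\<forall>w\<in>closure (scaled_domain (z n)) \<inter> cball 0 R. t *\<^sub>R w \<in> closure D) \<and>
      (\<forall>w\<in>closure D \<inter> cball 0 R. t *\<^sub>R w \<in> closure (scaled_domain (z n)))"
    using zG by (auto simp: filterlim_iff)
qed

theorem intrinsic_tendsto:
  fixes f :: "(complex^'d) set \<times> (complex^'d) \<Rightarrow> real"
  assumes cont: "continuous_map local_hausdorff_topology euclideanreal f" and f: "intrinsic f"
  shows "((\<lambda>z. f (\<Omega>, z)) \<longlongrightarrow> f (ball 0 1, 0)) (at \<xi> within \<Omega>)"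
proof -
  have \<Omega>: "\<Omega> \<in> \<X>" by (rule bounded_convex_domain_in_\<X>[OF domain])
  have "convex_domain (ball 0 1 :: (complex^'d) set)"
    by (simp add: convex_domain_def convex_ball)
  then have ball: "(ball 0 1, 0) \<in> (\<X>\<^sub>0 :: ((complex^'d) set \<times> _) set)"
    using bounded_convex_domain_in_\<X>[OF _ bounded_ball] by (auto simp: \<X>\<^sub>0_def)
  have fD: "f (D, 0) = f (ball 0 1, 0)"
    using biholomorphic_to_ball f D_in_\<X>\<^sub>0 ball unfolding intrinsic_def by metis
  have "at \<xi> within \<Omega> = at \<xi> within (\<Omega> \<inter> U)"
    by (rule at_within_nhd[OF U(2,1)]) auto
  moreover have "((\<lambda>z. f (\<Omega>, z)) \<longlongrightarrow> f (D, 0)) (at \<xi> within (\<Omega> \<inter> U))"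
    unfolding tendsto_at_iff_sequentially
  proof (intro allI impI)
    fix z :: "nat \<Rightarrow> complex^'d"
    assume "\<forall>n. z n \<in> \<Omega> \<inter> U - {\<xi>}" and lim: "z \<longlonglongrightarrow> \<xi>"
    then have z: "z n \<in> \<Omega> \<inter> U" for n by blast
    have r: "r (z n) < 0" for n using z[of n] inside by auto
    have scaled: "(scaled_domain (z n), 0) \<in> \<X>\<^sub>0" for n
    proof -
      have "bounded (scaled_domain (z n))"
        by (rule biholomorphism_scaled_domain[OF r[of n]])
      then show ?thesis
        using convex_domain_scaled_domain[of "z n"] z[of n] bounded_convex_domain_in_\<X>
        by (simp add: \<X>\<^sub>0_def)
    qed
    have "f (\<Omega>, z n) = f (scaled_domain (z n), 0)" for n
    proof -
      obtain \<phi> where "biholomorphism \<phi> \<Omega> (scaled_domain (z n))" "\<phi> (z n) = 0"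
        using biholomorphism_scaled_domain[OF r[of n]] by blast
      moreover have "(\<Omega>, z n) \<in> \<X>\<^sub>0" using \<Omega> z[of n] by (simp add: \<X>\<^sub>0_def)
      ultimately show ?thesis using f scaled[of n] unfolding intrinsic_def by blast
    qed
    moreover have "(\<lambda>n. f (scaled_domain (z n), 0)) \<longlonglongrightarrow> f (D, 0)"
    proof -
      have "pointed_converges (\<lambda>n. (scaled_domain (z n), 0)) (D, 0)"
        using scaled_converges[OF z lim] by (simp add: pointed_converges_def)
      moreover have "range (\<lambda>n. (scaled_domain (z n), 0)) \<subseteq> \<X>\<^sub>0" using scaled by blast
      ultimately show ?thesis
        using cont D_in_\<X>\<^sub>0 unfolding continuous_pointed_iff by blast
    qed
    ultimately show "((\<lambda>z. f (\<Omega>, z)) \<circ> z) \<longlonglongrightarrow> f (D, 0)"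
      by (simp add: o_def)
  qed
  ultimately show ?thesis by (simp add: fD)
qed

end

section \<open>Boundary limits of continuous intrinsic functions\<close>

theorem proposition1p13:
  fixes f :: "(complex^'d) set \<times> (complex^'d) \<Rightarrow> real"
    and \<Omega> :: "(complex^'d) set" and \<xi> :: "complex^'d"
  assumes "continuous_map local_hausdorff_topology euclideanreal f"
    and "intrinsic f"
    and "convex_domain \<Omega>" and "bounded \<Omega>" and "C2_boundary \<Omega>"
    and "\<xi> \<in> frontier \<Omega>" and "strongly_pseudoconvex_at \<Omega> \<xi>"
  shows "((\<lambda>z. f (\<Omega>, z)) \<longlongrightarrow> f (ball 0 1, 0)) (at \<xi> within \<Omega>)"
proof -
  obtain U r where def_fun: "C2_defining_function \<Omega> \<xi> U r"
    and levi: "\<And>v. v \<in> complex_tangent r \<xi> \<Longrightarrow> v \<noteq> 0 \<Longrightarrow> 0 < Re (levi_form r \<xi> v)"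
    using assms(7) unfolding strongly_pseudoconvex_at_def by blast
  then have U: "open U" "\<xi> \<in> U" and C2: "C2_on U r"
    and sets: "\<Omega> \<inter> U = {z \<in> U. r z < 0}" "frontier \<Omega> \<inter> U = {z \<in> U. r z = 0}"
    and grad: "\<exists>v. frechet_derivative r (at \<xi>) v \<noteq> 0"
    unfolding C2_defining_function_def by auto
  obtain r' r'' where r': "\<And>x. x \<in> U \<Longrightarrow> (r has_derivative blinfun_apply (r' x)) (at x)"
    and r'': "\<And>x. x \<in> U \<Longrightarrow> (r' has_derivative blinfun_apply (r'' x)) (at x)"
    and cont: "continuous_on U r''"
    using C2 unfolding C2_on_def by blast
  obtain v where "r' \<xi> v \<noteq> 0"
    using grad frechet_derivative_at[OF r'[OF U(2)]] by metis
  then have v: "complex_differential r' \<xi> v \<noteq> 0"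
    by (auto simp: complex_differential_def complex_eq_iff)
  define e where "e = inverse (complex_differential r' \<xi> v) *s v"
  interpret strongly_pseudoconvex_point \<Omega> U \<xi> e r r' r''
  proof
    show "complex_differential r' \<xi> e = 1"
      using v by (simp add: e_def complex_differential_scale)
    fix u assume "complex_differential r' \<xi> u = 0" "u \<noteq> 0"
    then show "0 < r'' \<xi> u u + r'' \<xi> (\<i> *s u) (\<i> *s u)"
      using levi[of u] by (simp add: complex_tangent_eq[OF U(1) r' r'' U(2)] Re_levi_form[OF U(1) r' r'' U(2)])
  qed (use U sets assms r' r'' cont in auto)
  show ?thesis by (rule intrinsic_tendsto[OF assms(1,2)])
qed

end
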